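(* Let $\mathbb{T}$ be the smallest collection of families of subsets of $\mathbb{N}$ such that: (1) if $\mathcal{B}$ is a linear Rado family or a geometric Rado family, then $\mathcal{B}\in\mathbb{T}$; (2) if $\mathcal{B}\in\mathbb{T}$, then for every finite set $P$ of integral polynomials and every $m\in\mathbb{N}$, the family $$\Big\{\{a,\ ab,\ a+p(b) : a\in A,\ b\in B,\ p\in P\} : A\in \tbinom{\mathbb{N}}{m},\ B\in\mathcal{B}\Big\}$$ belongs to $\mathbb{T}$. Then for every $\mathcal{B}\in\mathbb{T}$ and every finite set $P$ of integral polynomials, the family $$\Big\{\{a,\ ab,\ a+p(b) : a\in A,\ b\in B,\ p\in P\} : A\in \tbinom{\mathbb{N}}{\infty},\ B\in\mathcal{B}\Big\}$$ is Ramsey.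
   Context: $\mathbb{N}=\{1,2,3,\dots\}$. $\binom{\mathbb{N}}{m}$ is the family of all $m$-element subsets of $\mathbb{N}$, and $\binom{\mathbb{N}}{\infty}$ is the family of all infinite subsets of $\mathbb{N}$. A family $\mathcal{B}\subseteq\mathcal{P}(\mathbb{N})$ is Ramsey if for every $r\in\mathbb{N}$ and every coloring $c:\mathbb{N}\to\{1,\dots,r\}$ there is some $B\in\mathcal{B}$ such that $c$ is constant on $B$. A linear Rado family is a Ramsey family of the form $\{\{x_1,\dots,x_k\} : x_1,\dots,x_k\in\mathbb{N},\ \sum_{j=1}^k m_{ij}x_j=0 \text{ for all } i=1,\dots,\ell\}$, where $(m_{ij})$ is an $\ell\times k$ integer matrix; that is, it is the family of solution sets of a finite system of homogeneous linear equations, and this family is Ramsey. A geometric Rado family is the multiplicative analogue of a linear Rado family: whenever $(m_{ij})$ is an $\ell\times k$ integer matrix for which the family $\{\{x_1,\dots,x_k\} : x_1,\dots,x_k\in\mathbb{N},\ \sum_{j=1}^k m_{ij}x_j=0 \text{ for all } i=1,\dots,\ell\}$ is Ramsey, the family $\{\{x_1,\dots,x_k\} : x_1,\dots,x_k\in\mathbb{N},\ \prod_{j=1}^k x_j^{m_{ij}}=1 \text{ for all } i=1,\dots,\ell\}$ is a geometric Rado family (it is Ramsey, as one sees by composing colorings with $n\mapsto 2^n$). For example, $\{\{x,y,z\}:x+y=z\}$ is a linear Rado family and $\{\{x,y,z\}:xy=z\}$ is a geometric Rado family. An integral polynomial is a one-variable polynomial with nonnegative integer coefficients and zero constant term (the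 zero polynomial is allowed). *)

theory Defs
  imports
    Complex_Main
    "HOL-Library.Ramsey"
    "HOL-Computational_Algebra.Polynomial"
begin

text \<open>The set of positive integers is \<open>{1..}\<close>. Colorings are total functions on \<^typ>\<open>nat\<close>;
  only their values on \<open>{1..}\<close> matter.\<close>

definition ramsey_family :: "nat set set \<Rightarrow> bool" where
  "ramsey_family \<B> \<longleftrightarrow> \<B> \<subseteq> Pow {1..} \<and>
     (\<forall>r\<ge>1. \<forall>c::nat \<Rightarrow> nat. c ` {1..} \<subseteq> {1..r} \<longrightarrow> (\<exists>B\<in>\<B>. \<exists>i. \<forall>x\<in>B. c x = i))"

text \<open>An \<open>l \<times> k\<close> integer matrix is given by the entries \<open>M i j\<close> with \<open>1 \<le> i \<le> l\<close>, \<open>1 \<le> j \<le> k\<close>.\<close>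

definition linear_solutions :: "nat \<Rightarrow> nat \<Rightarrow> (nat \<Rightarrow> nat \<Rightarrow> int) \<Rightarrow> nat set set" where
  "linear_solutions l k M =
     {x ` {1..k} | x :: nat \<Rightarrow> nat.
        (\<forall>j\<in>{1..k}. x j \<ge> 1) \<and> (\<forall>i\<in>{1..l}. (\<Sum>j=1..k. M i j * int (x j)) = 0)}"

text \<open>Matrix entries may be negative, so the monomials are evaluated in the rationals.\<close>

definition geometric_solutions :: "nat \<Rightarrow> nat \<Rightarrow> (nat \<Rightarrow> nat \<Rightarrow> int) \<Rightarrow> nat set set" where
  "geometric_solutions l k M =
     {x ` {1..k} | x :: nat \<Rightarrow> nat.
        (\<forall>j\<in>{1..k}. x j \<ge> 1) \<and> (\<forall>i\<in>{1..l}. (\<Prod>j=1..k. (of_nat (x j) :: rat) powi M i j) = 1)}"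

definition linear_rado_family :: "nat set set \<Rightarrow> bool" where
  "linear_rado_family \<B> \<longleftrightarrow>
     (\<exists>l\<ge>1. \<exists>k\<ge>1. \<exists>M. \<B> = linear_solutions l k M \<and> ramsey_family \<B>)"

definition geometric_rado_family :: "nat set set \<Rightarrow> bool" where
  "geometric_rado_family \<B> \<longleftrightarrow>
     (\<exists>l\<ge>1. \<exists>k\<ge>1. \<exists>M. \<B> = geometric_solutions l k M \<and> ramsey_family (linear_solutions l k M))"

definition integral_poly :: "nat poly \<Rightarrow> bool" where
  "integral_poly p \<longleftrightarrow> coeff p 0 = 0"

text \<open>The set \<open>{a, ab, a + p(b) : a \<in> A, b \<in> B, p \<in> P}\<close>, read as the union of the three sets of
  values. For empty \<open>P\<close> it still contains all \<open>a\<close> and \<open>ab\<close>, exactly as for \<open>P = {0}\<close>.\<close>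

definition poly_pattern :: "nat poly set \<Rightarrow> nat set \<Rightarrow> nat set \<Rightarrow> nat set" where
  "poly_pattern P A B =
     A \<union> {a * b | a b. a \<in> A \<and> b \<in> B} \<union> {a + poly p b | a b p. a \<in> A \<and> b \<in> B \<and> p \<in> P}"

definition finite_pattern_family :: "nat poly set \<Rightarrow> nat \<Rightarrow> nat set set \<Rightarrow> nat set set" where
  "finite_pattern_family P m \<B> = {poly_pattern P A B | A B. A \<in> nsets {1..} m \<and> B \<in> \<B>}"

definition infinite_pattern_family :: "nat poly set \<Rightarrow> nat set set \<Rightarrow> nat set set" where
  "infinite_pattern_family P \<B> =
     {poly_pattern P A B | A B. A \<subseteq> {1..} \<and> infinite A \<and> B \<in> \<B>}"

inductive_set rado_tower :: "nat set set set" where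
  linear: "linear_rado_family \<B> \<Longrightarrow> \<B> \<in> rado_tower"
| geometric: "geometric_rado_family \<B> \<Longrightarrow> \<B> \<in> rado_tower"
| pattern: "\<lbrakk>\<B> \<in> rado_tower; finite P; \<forall>p\<in>P. integral_poly p; m \<ge> 1\<rbrakk>
    \<Longrightarrow> finite_pattern_family P m \<B> \<in> rado_tower"

end

theory Submission
  imports Defs "HOL-Analysis.Function_Topology" "HOL-Library.Multiset_Order"
begin

text \<open>Call a set large if it is piecewise syndetic. A large set \<open>D\<close> meets many of its translates along
  integral polynomials (polynomial van der Waerden, by PET induction), so one can choose multipliers
  \<open>y\<^sub>1, y\<^sub>2, \<dots>\<close> one after the other, each a multiple of the previous ones, and shrink \<open>D\<close> so that
  \<open>x y\<^sub>1 \<cdots> y\<^sub>j\<close> has a colour independent of \<open>x \<in> D\<close>. Once two of these colours agree, say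
  at \<open>i < j\<close>, the numbers \<open>a = x y\<^sub>1 \<cdots> y\<^sub>i\<close> and \<open>b = y\<^sub>i\<^sub>+\<^sub>1 \<cdots> y\<^sub>j\<close> give \<open>a\<close>, \<open>ab\<close>, \<open>a + p(b)\<close>
  of one colour for all \<open>x \<in> D\<close> (Moreira's argument). To let \<open>b\<close> range over a member of the given
  family, each \<open>y\<^sub>j\<close> is replaced by a finite set. For linear Rado families and for patterns, such a set can
  be monochromatic and stay good under finitely many dilations, also when one dilation factor is a formal
  variable that is specialised afterwards; this is why the induction over the tower runs in a polynomial
  ring in infinitely many variables. For geometric Rado families, \<open>b\<close> ranges over the products
  \<open>\<Prod>\<^sub>i v\<^sub>i\<^bsup>\<beta>(i,e)\<^esup>\<close>, where each \<open>\<beta>(i,\<cdot>)\<close> solves the linear system, and a Ramsey argument for the product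
  of the solution families makes the colours depend only on the length of the product.\<close>

section \<open>Piecewise syndetic sets\<close>

definition monochromatic :: "('a \<Rightarrow> 'c) \<Rightarrow> 'a set \<Rightarrow> bool" where
  "monochromatic \<chi> F \<longleftrightarrow> (\<exists>k. \<forall>x\<in>F. \<chi> x = k)"

lemma monochromatic_subset: "monochromatic \<chi> F \<Longrightarrow> G \<subseteq> F \<Longrightarrow> monochromatic \<chi> G"
  by (auto simp: monochromatic_def)

lemma monochromaticI:
  assumes "\<And>x y. x \<in> F \<Longrightarrow> y \<in> F \<Longrightarrow> \<chi> x = \<chi> y" shows "monochromatic \<chi> F"
proof (cases "F = {}")
  case False
  then obtain a where "a \<in> F" by blast
  with assms have "\<forall>x\<in>F. \<chi> x = \<chi> a" by blast
  then show ?thesis unfolding monochromatic_def by (rule exI)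
qed (simp add: monochromatic_def)

lemma monochromaticD:
  assumes "monochromatic \<chi> F" "x \<in> F" "y \<in> F" shows "\<chi> x = \<chi> y"
proof -
  obtain k where "\<forall>x\<in>F. \<chi> x = k" using assms(1) unfolding monochromatic_def by (elim exE)
  then show ?thesis using assms(2,3) by simp
qed

text \<open>By Tychonoff the space of all \<open>K\<close>-colourings is compact, and being constant
  on a given finite \<open>F\<close> is an open condition. The Ramsey property says that these open
  sets cover the space; \<open>\<G>\<close> comes from a finite subcover.\<close>

lemma finite_ramsey_subfamily:
  fixes K :: "'c set" and \<F> :: "'a set set"
  assumes K: "finite K" and fin: "\<And>F. F \<in> \<F> \<Longrightarrow> finite F"
    and ramsey: "\<And>\<chi>. (\<And>x. \<chi> x \<in> K) \<Longrightarrow> \<exists>F\<in>\<F>. monochromatic \<chi> F"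
  obtains \<G> where "\<G> \<subseteq> \<F>" "finite \<G>"
    "\<And>\<chi>. (\<And>x. \<chi> x \<in> K) \<Longrightarrow> \<exists>F\<in>\<G>. monochromatic \<chi> F"
proof -
  define X where "X = product_topology (\<lambda>_::'a. discrete_topology K) UNIV"
  have top: "topspace X = (UNIV \<rightarrow>\<^sub>E K)" by (simp add: X_def)
  have cpt: "compact_space X"
    unfolding X_def by (simp add: compact_space_product_topology compact_space_discrete_topology K)
  define U where "U F = (\<Union>k\<in>K. topspace X \<inter> (\<Inter>x\<in>F. {\<chi>\<in>topspace X. \<chi> x \<in> {k}}))" for F
  have U_iff: "\<chi> \<in> U F \<longleftrightarrow> \<chi> \<in> topspace X \<and> monochromatic \<chi> F" for \<chi> F
  proof -
    have "monochromatic \<chi> F \<longleftrightarrow> (\<exists>k\<in>K. \<forall>x\<in>F. \<chi> x = k)" if "\<And>x. \<chi> x \<in> K"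
      unfolding monochromatic_def using that by (metis all_not_in_conv)
    then show ?thesis unfolding U_def top by (auto simp: PiE_iff)
  qed
  have "openin X (U F)" if "F \<in> \<F>" for F
  proof -
    have "openin X {\<chi>\<in>topspace X. \<chi> x \<in> {k}}" if "k \<in> K" for x k
      by (rule openin_continuous_map_preimage[of X "discrete_topology K"])
        (use that in \<open>auto simp: X_def intro!: continuous_map_product_coordinates\<close>)
    then show ?thesis
      unfolding U_def using fin[OF that]
      by (cases "F = {}") (auto intro!: openin_Union openin_Inter openin_Int)
  qed
  moreover have "topspace X \<subseteq> \<Union>(U ` \<F>)"
  proof
    fix \<chi> assume \<chi>: "\<chi> \<in> topspace X"
    then have "\<And>x. \<chi> x \<in> K" by (auto simp: top PiE_iff)
    then show "\<chi> \<in> \<Union>(U ` \<F>)" using ramsey[of \<chi>] \<chi> U_iff by blast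
  qed
  ultimately obtain \<H> where \<H>: "finite \<H>" "\<H> \<subseteq> U ` \<F>" "topspace X \<subseteq> \<Union>\<H>"
    using cpt unfolding compact_space_alt by (metis (no_types, lifting) imageE)
  then obtain \<G> where \<G>: "\<G> \<subseteq> \<F>" "finite \<G>" "\<H> = U ` \<G>"
    by (meson finite_subset_image)
  show thesis
  proof (rule that[OF \<G>(1,2)])
    fix \<chi> :: "'a \<Rightarrow> 'c" assume "\<And>x. \<chi> x \<in> K"
    then have "\<chi> \<in> topspace X" by (auto simp: top)
    then show "\<exists>F\<in>\<G>. monochromatic \<chi> F" using \<H>(3) \<G>(3) U_iff by blast
  qed
qed

section \<open>Large subsets of a ring with a positive cone\<close>

locale positive_cone =
  fixes S :: "'a::comm_ring_1 set"
  assumes one: "1 \<in> S"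
    and add: "x \<in> S \<Longrightarrow> y \<in> S \<Longrightarrow> x + y \<in> S"
    and mult: "x \<in> S \<Longrightarrow> y \<in> S \<Longrightarrow> x * y \<in> S"
    and diff: "\<exists>s\<in>S. \<exists>t\<in>S. x = s - t"
begin

definition thick_cover :: "'a set \<Rightarrow> 'a set \<Rightarrow> bool" where
  "thick_cover H D \<longleftrightarrow> (\<forall>F. finite F \<longrightarrow> (\<exists>t. \<forall>f\<in>F. \<exists>h\<in>H. t + f + h \<in> D))"

text \<open>Piecewise syndeticity in the additive group: the union of the translates of
  \<open>D\<close> by \<open>-h\<close>, \<open>h \<in> H\<close>, is thick, that is, contains a
  translate of every finite set.\<close>

definition large :: "'a set \<Rightarrow> bool" where
  "large D \<longleftrightarrow> (\<exists>H. finite H \<and> thick_cover H D)"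

lemma largeI:
  "finite H \<Longrightarrow> (\<And>F. finite F \<Longrightarrow> \<exists>t. \<forall>f\<in>F. \<exists>h\<in>H. t + f + h \<in> D) \<Longrightarrow> large D"
  unfolding large_def thick_cover_def by blast

lemma largeE:
  assumes "large D"
  obtains H where "finite H" "\<And>F. finite F \<Longrightarrow> \<exists>t. \<forall>f\<in>F. \<exists>h\<in>H. t + f + h \<in> D"
  using assms unfolding large_def thick_cover_def by blast

lemma large_UNIV: "large UNIV"
  by (rule largeI[of "{0}"]) auto

lemma not_large_empty: "\<not> large {}"
  unfolding large_def thick_cover_def by (auto intro!: exI[of _ "{0}"])

lemma large_nonempty: "large D \<Longrightarrow> D \<noteq> {}"
  using not_large_empty by blast

lemma large_translate: "large D \<Longrightarrow> large {x. x + a \<in> D}"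
proof -
  assume "large D"
  then obtain H where H: "finite H" "\<And>F. finite F \<Longrightarrow> \<exists>t. \<forall>f\<in>F. \<exists>h\<in>H. t + f + h \<in> D"
    by (rule largeE) (rule that)
  have "\<exists>t. \<forall>f\<in>F. \<exists>h\<in>H. t + f + h + a \<in> D" if F: "finite F" for F
  proof -
    obtain t where "\<forall>f\<in>F. \<exists>h\<in>H. t + f + h \<in> D" using H(2)[OF F] by blast
    then have "\<forall>f\<in>F. \<exists>h\<in>H. (t - a) + f + h + a \<in> D" by (simp add: algebra_simps)
    then show ?thesis by blast
  qed
  with H(1) show ?thesis by (intro largeI[of H]) auto
qed

lemma translate_into_cone: "finite F \<Longrightarrow> \<exists>t\<in>S. \<forall>f\<in>F. t + f \<in> S"
proof (induction F rule: finite_induct)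
  case empty
  then show ?case using one by blast
next
  case (insert x F)
  then obtain t where t: "t \<in> S" "\<forall>f\<in>F. t + f \<in> S" by blast
  obtain s s' where s: "s \<in> S" "s' \<in> S" "x = s - s'" using diff by blast
  have "t + s' + f \<in> S" if "f \<in> F" for f
    using add[OF t(2)[rule_format, OF that] s(2)] by (simp add: algebra_simps)
  moreover have "t + s' + x \<in> S" using add[OF t(1) s(1)] by (simp add: s(3))
  ultimately show ?case using add[OF t(1) s(2)] by blast
qed

lemma large_cone: "large S"
  by (rule largeI[of "{0}"]) (use translate_into_cone in auto)

text \<open>Partition regularity. If the \<open>H\<close> that serves the union fails for
  \<open>E\<close>, some finite \<open>G\<close> has in each of its translates a point all of whose
  \<open>H\<close>-shifts miss \<open>E\<close>. One of these shifts then lies in \<open>D\<close>,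
  so the sums \<open>g + h\<close> serve \<open>D\<close>.\<close>

lemma large_Un: assumes "large (D \<union> E)" shows "large D \<or> large E"
proof (rule disjCI)
  assume E: "\<not> large E"
  obtain H where H: "finite H" "\<And>F. finite F \<Longrightarrow> \<exists>t. \<forall>f\<in>F. \<exists>h\<in>H. t + f + h \<in> D \<union> E"
    using assms by (rule largeE) (rule that)
  obtain G where G: "finite G" "\<And>t. \<exists>g\<in>G. \<forall>h\<in>H. t + g + h \<notin> E"
  proof -
    have "\<not> thick_cover H E" using E H(1) large_def by blast
    then show thesis using that unfolding thick_cover_def by auto
  qed
  define H' where "H' = (\<lambda>(g, h). g + h) ` (G \<times> H)"
  have "\<exists>t. \<forall>f\<in>F. \<exists>h\<in>H'. t + f + h \<in> D" if F: "finite F" for F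
  proof -
    have "finite ((\<lambda>(f, g). f + g) ` (F \<times> G))" using F G(1) by blast
    from H(2)[OF this] obtain t where
      t: "\<And>f g. f \<in> F \<Longrightarrow> g \<in> G \<Longrightarrow> \<exists>h\<in>H. t + (f + g) + h \<in> D \<union> E" by fastforce
    have "\<exists>h\<in>H'. t + f + h \<in> D" if f: "f \<in> F" for f
    proof -
      obtain g where g: "g \<in> G" "\<forall>h\<in>H. (t + f) + g + h \<notin> E" using G(2) by blast
      obtain h where h: "h \<in> H" "t + (f + g) + h \<in> D \<union> E" using t[OF f g(1)] by blast
      then have "t + f + (g + h) \<in> D" using g(2) by (auto simp: add.assoc)
      then show ?thesis unfolding H'_def using g(1) h(1) by blast
    qed
    then show ?thesis by blast
  qed
  moreover have "finite H'" unfolding H'_def using G(1) H(1) by blast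
  ultimately show "large D" by (intro largeI[of H'])
qed

lemma large_UN: "finite I \<Longrightarrow> large (\<Union>i\<in>I. D i) \<Longrightarrow> \<exists>i\<in>I. large (D i)"
proof (induction I rule: finite_induct)
  case empty then show ?case using not_large_empty by simp
next
  case (insert i I)
  then show ?case using large_Un[of "D i" "\<Union>i\<in>I. D i"] by auto
qed

lemma large_colour_class:
  assumes "large D" "finite (f ` D)"
  shows "\<exists>c. large {x\<in>D. f x = c}"
proof -
  have "D = (\<Union>c\<in>f ` D. {x\<in>D. f x = c})" by blast
  then show ?thesis using large_UN[OF assms(2), of "\<lambda>c. {x\<in>D. f x = c}"] assms(1) by auto
qed

text \<open>An increasing sequence in the order given by \<open>S\<close>. It stands for
  \<open>n\<close> distinct elements in a form that survives evaluation: a chain in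
  \<open>cone\<close> keeps distinct values whatever the variables are set to.\<close>

definition chain_in :: "'a set \<Rightarrow> nat \<Rightarrow> (nat \<Rightarrow> 'a) \<Rightarrow> bool" where
  "chain_in A n a \<longleftrightarrow> (\<forall>i<n. a i \<in> A) \<and> (\<forall>i<n. \<forall>j<i. a i - a j \<in> S)"

lemma of_nat_mult_add: "g \<in> S \<Longrightarrow> h \<in> S \<Longrightarrow> of_nat n * g + h \<in> S"
proof (induction n)
  case (Suc n)
  then show ?case using add[of g "of_nat n * g + h"] by (simp add: algebra_simps)
qed simp

lemma large_chain: assumes "large D" shows "\<exists>a. chain_in D n a"
proof -
  obtain H where H: "finite H" "\<And>F. finite F \<Longrightarrow> \<exists>t. \<forall>f\<in>F. \<exists>h\<in>H. t + f + h \<in> D"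
    using assms by (rule largeE) (rule that)
  \<comment> \<open>The step \<open>g\<close> of the progression outweighs every difference of
    elements of \<open>H\<close>, so the unknown corrections \<open>h i\<close> cannot spoil the
    order.\<close>
  have "finite ((\<lambda>(h, h'). h - h') ` (H \<times> H))" using H(1) by blast
  from translate_into_cone[OF this] obtain g where
    g: "g \<in> S" "\<And>h h'. h \<in> H \<Longrightarrow> h' \<in> H \<Longrightarrow> g + (h - h') \<in> S" by fastforce
  have "finite ((\<lambda>i. of_nat i * g) ` {..<n})" by blast
  from H(2)[OF this] obtain t where "\<forall>i<n. \<exists>h\<in>H. t + of_nat i * g + h \<in> D" by auto
  then obtain h where h: "\<And>i. i < n \<Longrightarrow> h i \<in> H \<and> t + of_nat i * g + h i \<in> D" by metis
  define a where "a i = t + of_nat i * g + h i" for i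
  have "a i - a j \<in> S" if ij: "i < n" "j < i" for i j
  proof -
    obtain k where k: "i = Suc (j + k)" using ij(2) less_imp_Suc_add by blast
    have "a i - a j = of_nat k * g + (g + (h i - h j))"
      unfolding a_def k by (simp add: algebra_simps)
    also have "\<dots> \<in> S"
      by (rule of_nat_mult_add[OF g(1) g(2)]) (use h ij in auto)
    finally show ?thesis .
  qed
  moreover have "a i \<in> D" if "i < n" for i using h[OF that] by (simp add: a_def)
  ultimately show ?thesis unfolding chain_in_def by blast
qed

lemma chain_in_mult:
  assumes "chain_in A n a" "m \<in> S" shows "chain_in ((\<lambda>x. x * m) ` A) n (\<lambda>i. a i * m)"
  using assms mult unfolding chain_in_def
  by (auto simp: left_diff_distrib[symmetric])

text \<open>Colour focusing: in state \<open>(T, V, E)\<close>, every point \<open>x \<in> E\<close> sees the colour \<open>t \<in> T\<close> at all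
  points \<open>x + q(V t)\<close>. Each step either closes up or adds a new colour to \<open>T\<close>.\<close>

lemma colour_focusing:
  fixes \<chi> :: "'a \<Rightarrow> 'c"
  assumes K: "finite K" "\<And>x. \<chi> x \<in> K"
    and Q0: "\<And>q. q \<in> Q \<Longrightarrow> poly q 0 = 0"
    and rec: "\<And>D W. finite W \<Longrightarrow> large D \<Longrightarrow>
      \<exists>v\<in>S. large {x\<in>D. \<forall>V\<in>W. \<forall>q\<in>Q. x + (poly q (V + v) - poly q V - poly p v) \<in> D}"
  shows "\<exists>x. \<exists>v\<in>S. \<forall>q\<in>Q. \<chi> (x + poly q v) = \<chi> x"
proof (rule ccontr)
  assume neg: "\<not> ?thesis"
  have "\<exists>T V E. card T = n \<and> T \<subseteq> K \<and> large E \<and> (\<forall>t\<in>T. V t \<in> insert 0 S) \<and>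
      (\<forall>t\<in>T. \<forall>x\<in>E. \<forall>q\<in>Q. \<chi> (x + poly q (V t)) = t)" for n
  proof (induction n)
    case 0
    show ?case by (rule exI[of _ "{}"]) (use large_UNIV in auto)
  next
    case (Suc n)
    then obtain T V E where T: "card T = n" "T \<subseteq> K" "large E" "\<And>t. t \<in> T \<Longrightarrow> V t \<in> insert 0 S"
      and see: "\<And>t x q. t \<in> T \<Longrightarrow> x \<in> E \<Longrightarrow> q \<in> Q \<Longrightarrow> \<chi> (x + poly q (V t)) = t" by blast
    have finT: "finite T" using T(2) K(1) finite_subset by blast
    obtain v where v: "v \<in> S" and
      "large {x\<in>E. \<forall>u\<in>V ` T. \<forall>q\<in>Q. x + (poly q (u + v) - poly q u - poly p v) \<in> E}" (is "large ?F")
      using rec[of "V ` T" E] finT T(3) by blast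
    \<comment> \<open>Translating by \<open>p(v)\<close> cancels the term \<open>- p(v)\<close>, so
      that \<open>x + q(V t + v)\<close> is a point of the old \<open>E\<close> plus
      \<open>q(V t)\<close> and has the colour \<open>t\<close>.\<close>
    from large_translate[OF this(2), of "poly p v"]
    have "large {x. x + poly p v \<in> ?F}" .
    moreover have "finite (\<chi> ` {x. x + poly p v \<in> ?F})"
      using K by (meson finite_subset image_subsetI)
    ultimately obtain c where c: "large {x\<in>{x. x + poly p v \<in> ?F}. \<chi> x = c}" (is "large ?E")
      using large_colour_class by blast
    have see': "\<chi> (x + poly q (V t + v)) = t" if "t \<in> T" "x \<in> ?E" "q \<in> Q" for t x q
    proof -
      have "x + poly p v + (poly q (V t + v) - poly q (V t) - poly p v) \<in> E"
        using that by blast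
      from see[OF that(1) this that(3)] show ?thesis by (simp add: algebra_simps)
    qed
    have V': "V t + v \<in> S" if "t \<in> T" for t using T(4)[OF that] v add by auto
    obtain x where x: "x \<in> ?E" using large_nonempty[OF c] by blast
    have "c \<in> K" using x K(2) by blast
    \<comment> \<open>Otherwise \<open>x\<close> and all \<open>x + q(V c + v)\<close> share the
      colour \<open>c\<close>, contrary to \<open>neg\<close>.\<close>
    have "c \<notin> T"
    proof
      assume "c \<in> T"
      then have "\<forall>q\<in>Q. \<chi> (x + poly q (V c + v)) = \<chi> x" using see' x by simp
      then show False using neg V'[OF \<open>c \<in> T\<close>] by blast
    qed
    \<comment> \<open>The new colour gets the shift 0, as \<open>q(0) = 0\<close>. This is why
      \<open>V t\<close> ranges over \<open>insert 0 S\<close>; the next step adds an element of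
      \<open>S\<close>.\<close>
    then show ?case
      using T finT \<open>c \<in> K\<close> c see' V' Q0
      by (intro exI[of _ "insert c T"] exI[of _ "(\<lambda>t. V t + v)(c := 0)"] exI[of _ ?E]) auto
  qed
  then obtain T where "card T = Suc (card K)" "T \<subseteq> K" by blast
  then show False using card_mono[OF K(1), of T] by simp
qed

text \<open>Colour \<open>y\<close> by some \<open>h \<in> H\<close> with
  \<open>t + f + y + h \<in> D\<close>. A monochromatic set of \<open>x\<close> and all
  \<open>x + q(v)\<close> then yields a point of \<open>D\<close> whose shifts by the
  \<open>q(v)\<close> stay in \<open>D\<close>. By compactness finitely many pairs
  \<open>(x, v)\<close> suffice, so the points obtained form a large set, and partition regularity
  singles out one \<open>v\<close>.\<close>

lemma recurrence_of_colouring: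
  assumes Q: "finite Q"
    and col: "\<And>\<chi> :: 'a \<Rightarrow> 'a. \<And>K. finite K \<Longrightarrow> (\<And>x. \<chi> x \<in> K) \<Longrightarrow>
      \<exists>x. \<exists>v\<in>S. \<forall>q\<in>Q. \<chi> (x + poly q v) = \<chi> x"
    and D: "large D"
  shows "\<exists>v\<in>S. large {x\<in>D. \<forall>q\<in>Q. x + poly q v \<in> D}"
proof -
  obtain H where H: "finite H" "\<And>F. finite F \<Longrightarrow> \<exists>t. \<forall>f\<in>F. \<exists>h\<in>H. t + f + h \<in> D"
    using D by (rule largeE) (rule that)
  define conf where "conf = (\<lambda>(x, v). insert x ((\<lambda>q. x + poly q v) ` Q))"
  have 1: "finite F" if "F \<in> conf ` (UNIV \<times> S)" for F
    using that Q by (auto simp: conf_def)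
  have 2: "\<exists>F\<in>conf ` (UNIV \<times> S). monochromatic \<chi> F" if chi: "\<And>x. \<chi> x \<in> H" for \<chi> :: "'a \<Rightarrow> 'a"
  proof -
    obtain x v where "v \<in> S" "\<forall>q\<in>Q. \<chi> (x + poly q v) = \<chi> x" using col[of H \<chi>] H(1) chi by blast
    then show ?thesis by (intro bexI[of _ "conf (x, v)"]) (auto simp: conf_def monochromatic_def)
  qed
  obtain \<G> where \<G>: "\<G> \<subseteq> conf ` (UNIV \<times> S)" "finite \<G>"
    "\<And>\<chi>. (\<And>x. \<chi> x \<in> H) \<Longrightarrow> \<exists>F\<in>\<G>. monochromatic \<chi> F"
    using finite_ramsey_subfamily[OF H(1) 1 2] by metis
  obtain J where J: "finite J" "J \<subseteq> UNIV \<times> S" "\<G> = conf ` J"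
    using \<G>(1,2) by (meson finite_subset_image)
  define Y where "Y = \<Union>\<G>"
  have Y: "finite Y" unfolding Y_def using \<G>(1,2) 1 by blast
  define ret where "ret v = {x\<in>D. \<forall>q\<in>Q. x + poly q v \<in> D}" for v
  define H' where "H' = (\<lambda>(x, h). x + h) ` (fst ` J \<times> H)"
  have "\<exists>t. \<forall>f\<in>F. \<exists>h\<in>H'. t + f + h \<in> (\<Union>v\<in>snd ` J. ret v)" if F: "finite F" for F
  proof -
    have "finite ((\<lambda>(f, y). f + y) ` (F \<times> insert 0 Y))" using F Y by blast
    from H(2)[OF this] obtain t where
      t: "\<And>f y. f \<in> F \<Longrightarrow> y \<in> insert 0 Y \<Longrightarrow> \<exists>h\<in>H. t + (f + y) + h \<in> D" by fastforce
    have "\<exists>h\<in>H'. t + f + h \<in> (\<Union>v\<in>snd ` J. ret v)" if f: "f \<in> F" for f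
    proof -
      \<comment> \<open>Outside \<open>insert 0 Y\<close> any element of \<open>H\<close> serves;
        the 0 guarantees that \<open>H\<close> has one.\<close>
      define \<chi> where "\<chi> y = (SOME h. h \<in> H \<and> (y \<in> insert 0 Y \<longrightarrow> t + (f + y) + h \<in> D))" for y
      have \<chi>: "\<chi> y \<in> H \<and> (y \<in> insert 0 Y \<longrightarrow> t + (f + y) + \<chi> y \<in> D)" for y
        unfolding \<chi>_def by (rule someI_ex) (use t[OF f] in blast)
      obtain x v where xv: "(x, v) \<in> J" "monochromatic \<chi> (conf (x, v))"
        using \<G>(3)[of \<chi>] \<chi> J(3) by auto
      then have eq: "\<chi> y = \<chi> x" if "y \<in> conf (x, v)" for y
        using that unfolding monochromatic_def conf_def by fastforce
      have "conf (x, v) \<subseteq> Y" unfolding Y_def J(3) using xv(1) by blast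
      then have in_D: "t + (f + y) + \<chi> x \<in> D" if "y \<in> conf (x, v)" for y
        using \<chi>[of y] eq[OF that] that by auto
      have "t + f + (x + \<chi> x) \<in> ret v"
        using in_D[of x] in_D[of "x + poly q v" for q] unfolding ret_def conf_def
        by (auto simp: add_ac)
      then show ?thesis unfolding H'_def using xv(1) \<chi>[of x] by force
    qed
    then show ?thesis by blast
  qed
  moreover have "finite H'" unfolding H'_def using J(1) H(1) by blast
  ultimately have "large (\<Union>v\<in>snd ` J. ret v)" by (intro largeI[of H'])
  then obtain v where "v \<in> snd ` J" "large (ret v)" using large_UN J(1) by blast
  then show ?thesis using J(2) unfolding ret_def by auto
qed

end

section \<open>Polynomial recurrence\<close>

definition shifted :: "'a::comm_ring_1 \<Rightarrow> 'a poly \<Rightarrow> 'a poly" where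
  "shifted V q = pcompose q [:V, 1:]"

lemma poly_shifted: "poly (shifted V q) v = poly q (V + v)"
  by (simp add: shifted_def poly_pcompose)

lemma coeff_shifted:
  "(\<forall>n>degree q. coeff (shifted V q) n = 0) \<and> coeff (shifted V q) (degree q) = lead_coeff q"
proof (induction q)
  case 0
  then show ?case by (simp add: shifted_def)
next
  case (pCons a q)
  have eq: "shifted V (pCons a q) = [:a:] + (smult V (shifted V q) + pCons 0 (shifted V q))"
    by (simp add: shifted_def pcompose_pCons)
  show ?case
  proof (cases "q = 0")
    case True
    then show ?thesis by (auto simp: shifted_def pcompose_pCons coeff_pCons split: nat.split)
  next
    case False
    have "coeff (shifted V (pCons a q)) (Suc n) = V * coeff (shifted V q) (Suc n) + coeff (shifted V q) n" for n
      by (simp add: eq)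
    then show ?thesis using pCons.IH False by (auto simp: gr0_conv_Suc Suc_less_eq2 degree_pCons_eq)
  qed
qed

section \<open>Leading terms and the PET weight\<close>

definition top_terms :: "'a::comm_ring_1 poly set \<Rightarrow> (nat \<times> 'a) set" where
  "top_terms Q = (\<lambda>q. (degree q, lead_coeff q)) ` (Q - {0})"

text \<open>Polynomials with the same degree and leading coefficient count once, because the
  difference of two of them vanishes or has lower degree.\<close>

definition weight :: "'a::comm_ring_1 poly set \<Rightarrow> nat multiset" where
  "weight Q = image_mset fst (mset_set (top_terms Q))"

lemma count_image_mset_set:
  "finite A \<Longrightarrow> count (image_mset f (mset_set A)) d = card {x\<in>A. f x = d}"
proof (induction A rule: finite_induct)
  case (insert x A)
  have "{y\<in>insert x A. f y = d} = (if f x = d then insert x {y\<in>A. f y = d} else {y\<in>A. f y = d})"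
    by auto
  then show ?case using insert by simp
qed simp

lemma count_weight:
  assumes "finite Q" shows "count (weight Q) d = card {l. (d, l) \<in> top_terms Q}"
proof -
  have fin: "finite (top_terms Q)" using assms by (simp add: top_terms_def)
  have "count (weight Q) d = card {g \<in> top_terms Q. fst g = d}"
    unfolding weight_def by (rule count_image_mset_set[OF fin])
  also have "\<dots> = card (Pair d ` {l. (d, l) \<in> top_terms Q})"
    by (rule arg_cong[of _ _ card]) force
  also have "\<dots> = card {l. (d, l) \<in> top_terms Q}" by (intro card_image inj_onI) simp
  finally show ?thesis .
qed

definition difference_polys :: "'a::comm_ring_1 poly set \<Rightarrow> 'a set \<Rightarrow> 'a poly \<Rightarrow> 'a poly set" where
  "difference_polys Q W p = (\<lambda>(q, V). shifted V q - [:poly q V:] - p) ` (Q \<times> W)"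

text \<open>Subtracting \<open>p\<close> of least degree \<open>d\<close> leaves the leading terms
  of degree above \<open>d\<close> as they were. In degree \<open>d\<close> every leading
  coefficient drops by that of \<open>p\<close>, and the class of \<open>p\<close> disappears. New
  terms arise only below \<open>d\<close>, where the multiset order permits any number of
  them.\<close>

lemma weight_difference_polys:
  assumes Q: "finite Q" "finite W" and Q0: "\<And>q. q \<in> Q \<Longrightarrow> coeff q 0 = 0 \<and> q \<noteq> 0"
    and p: "p \<in> Q" and least: "\<And>q. q \<in> Q \<Longrightarrow> degree p \<le> degree q"
  shows "weight (difference_polys Q W p) < weight Q"
proof -
  let ?d = "degree p" and ?Q' = "difference_polys Q W p"
  have deg_pos: "degree q > 0" if "q \<in> Q" for q
  proof (rule ccontr)
    assume "\<not> degree q > 0"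
    then have "lead_coeff q = 0" using Q0[OF that] by simp
    then show False using Q0[OF that] by simp
  qed
  have fin': "finite ?Q'" using Q by (simp add: difference_polys_def)
  have fin_terms: "finite {l. (d, l) \<in> top_terms Q}" for d
  proof -
    have "{l. (d, l) \<in> top_terms Q} \<subseteq> snd ` top_terms Q" by force
    then show ?thesis using Q(1) by (auto simp: top_terms_def intro: finite_subset)
  qed
  have terms: "if e = ?d then (e, l + lead_coeff p) \<in> top_terms Q \<and> l \<noteq> 0 else (e, l) \<in> top_terms Q"
    if el: "(e, l) \<in> top_terms ?Q'" "e \<ge> ?d" for e l
  proof -
    obtain r where r': "r \<in> ?Q'" and r: "r \<noteq> 0" and e: "e = degree r" and l: "l = lead_coeff r"
      using el(1) unfolding top_terms_def by blast
    obtain q V where q: "q \<in> Q" and r_def: "r = shifted V q - [:poly q V:] - p"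
      using r' unfolding difference_polys_def by auto
    have top: "(degree q, lead_coeff q) \<in> top_terms Q"
      using q Q0[OF q] by (auto simp: top_terms_def)
    have const: "coeff [:poly q V:] n = 0" if "n > 0" for n using that by (cases n) auto
    have high: "coeff r n = 0" if "n > degree q" for n
      using that coeff_shifted[of q V] const[of n] least[OF q] by (auto simp: coeff_eq_0 r_def)
    have "degree r \<le> degree q" using high by (rule_tac degree_le) blast
    have mid: "coeff r (degree q) = lead_coeff q - coeff p (degree q)"
      using coeff_shifted[of q V] const[OF deg_pos[OF q]] by (simp add: r_def)
    show ?thesis
    proof (cases "degree q = ?d")
      case True
      then have "e = ?d" using el(2) e \<open>degree r \<le> degree q\<close> by simp
      moreover have "l = lead_coeff q - lead_coeff p" using mid l e \<open>e = ?d\<close> True by simp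
      moreover have "l \<noteq> 0" using l r by simp
      ultimately show ?thesis using top True by simp
    next
      case False
      then have gt: "degree q > ?d" using least[OF q] by simp
      then have "coeff r (degree q) = lead_coeff q" using mid by (simp add: coeff_eq_0)
      moreover have "lead_coeff q \<noteq> 0" using Q0[OF q] by simp
      ultimately have "degree q \<le> degree r" by (intro le_degree) simp
      then have "e = degree q" using e \<open>degree r \<le> degree q\<close> by simp
      then show ?thesis using e l gt top \<open>coeff r (degree q) = lead_coeff q\<close> by simp
    qed
  qed
  have gt: "count (weight ?Q') e \<le> count (weight Q) e" if "e > ?d" for e
    unfolding count_weight[OF Q(1)] count_weight[OF fin']
    by (rule card_mono[OF fin_terms]) (use terms[of e] that in force)
  have eq: "count (weight ?Q') ?d < count (weight Q) ?d"
  proof -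
    let ?L = "{l. (?d, l) \<in> top_terms Q}"
    \<comment> \<open>Adding back the leading coefficient of \<open>p\<close> embeds the new classes
      into the old ones; since \<open>l \<noteq> 0\<close>, that of \<open>p\<close> is
      missed.\<close>
    have "card {l. (?d, l) \<in> top_terms ?Q'} = card ((\<lambda>l. l + lead_coeff p) ` {l. (?d, l) \<in> top_terms ?Q'})"
      by (intro card_image[symmetric] inj_onI) simp
    also have "\<dots> \<le> card (?L - {lead_coeff p})"
      by (rule card_mono) (use fin_terms terms[of ?d] in auto)
    also have "\<dots> < card ?L"
      by (rule card_Diff1_less[OF fin_terms]) (use p Q0[OF p] in \<open>auto simp: top_terms_def\<close>)
    finally show ?thesis unfolding count_weight[OF Q(1)] count_weight[OF fin'] .
  qed
  show ?thesis
    unfolding less_multiset\<^sub>H\<^sub>O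
  proof (intro conjI allI impI)
    show "weight ?Q' \<noteq> weight Q" using eq by auto
    fix y assume "count (weight Q) y < count (weight ?Q') y"
    then have "y < ?d" using gt[of y] eq by (metis leD linorder_neqE_nat order.asym)
    then show "\<exists>x>y. count (weight ?Q') x < count (weight Q) x" using eq by blast
  qed
qed

context positive_cone
begin

text \<open>PET induction on the multiset of degrees of the distinct leading terms.\<close>

theorem polynomial_recurrence:
  assumes "finite Q" "\<forall>q\<in>Q. coeff q 0 = 0" "large D"
  shows "\<exists>v\<in>S. large {x\<in>D. \<forall>q\<in>Q. x + poly q v \<in> D}"
  using assms
proof (induction "weight Q" arbitrary: Q D rule: less_induct)
  case less
  \<comment> \<open>The zero polynomial imposes no condition, but would be picked as the one of
    least degree.\<close>
  define R where "R = Q - {0}"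
  have finR: "finite R" using less.prems by (simp add: R_def)
  have R0: "coeff q 0 = 0 \<and> q \<noteq> 0" if "q \<in> R" for q using that less.prems by (auto simp: R_def)
  have weightR: "weight R = weight Q" by (simp add: weight_def top_terms_def R_def)
  have reduce: "{x\<in>D. \<forall>q\<in>Q. x + poly q v \<in> D} = {x\<in>D. \<forall>q\<in>R. x + poly q v \<in> D}" for v
    by (auto simp: R_def)
  show ?case
  proof (cases "R = {}")
    case True
    then show ?thesis unfolding reduce using one less.prems(3) by auto
  next
    case False
    define p where "p = arg_min_on degree R"
    have p: "p \<in> R" "\<And>q. q \<in> R \<Longrightarrow> degree p \<le> degree q"
      using arg_min_if_finite(1)[OF finR False] arg_min_least[OF finR False] by (auto simp: p_def)
    \<comment> \<open>The induction hypothesis for the difference polynomials is what colour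
      focusing requires.\<close>
    have rec: "\<exists>v\<in>S. large {x\<in>D. \<forall>V\<in>W. \<forall>q\<in>R. x + (poly q (V + v) - poly q V - poly p v) \<in> D}"
      if W: "finite W" "large D" for D W
    proof -
      let ?Q' = "difference_polys R W p"
      have "weight ?Q' < weight Q"
        using weight_difference_polys[OF finR W(1) R0 p] weightR by simp
      moreover have "finite ?Q'" using finR W(1) by (simp add: difference_polys_def)
      moreover have "\<forall>q\<in>?Q'. coeff q 0 = 0"
        using R0 p(1) by (auto simp: difference_polys_def poly_0_coeff_0[symmetric] poly_shifted)
      ultimately obtain v where "v \<in> S" "large {x\<in>D. \<forall>q\<in>?Q'. x + poly q v \<in> D}"
        using less.hyps W(2) by blast
      moreover have "{x\<in>D. \<forall>q\<in>?Q'. x + poly q v \<in> D} =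
          {x\<in>D. \<forall>V\<in>W. \<forall>q\<in>R. x + (poly q (V + v) - poly q V - poly p v) \<in> D}"
        by (auto simp: difference_polys_def poly_shifted)
      ultimately show ?thesis by auto
    qed
    have "\<exists>x. \<exists>v\<in>S. \<forall>q\<in>R. \<chi> (x + poly q v) = \<chi> x" if "finite K" "\<And>x. \<chi> x \<in> K"
      for \<chi> :: "'a \<Rightarrow> 'a" and K
      by (rule colour_focusing[OF that, where p = p]) (use R0 rec in \<open>auto simp: poly_0_coeff_0\<close>)
    from recurrence_of_colouring[OF finR this less.prems(3)] show ?thesis
      unfolding reduce by blast
  qed
qed

end

section \<open>The ring of integer polynomials in countably many variables\<close>

inductive_set pos_fun :: "((nat \<Rightarrow> nat) \<Rightarrow> int) set" where
  one: "(\<lambda>_. 1) \<in> pos_fun"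
| var: "(\<lambda>\<rho>. int (Suc (\<rho> n))) \<in> pos_fun"
| add: "f \<in> pos_fun \<Longrightarrow> g \<in> pos_fun \<Longrightarrow> (\<lambda>\<rho>. f \<rho> + g \<rho>) \<in> pos_fun"
| mult: "f \<in> pos_fun \<Longrightarrow> g \<in> pos_fun \<Longrightarrow> (\<lambda>\<rho>. f \<rho> * g \<rho>) \<in> pos_fun"

lemma pos_fun_ge_1: "f \<in> pos_fun \<Longrightarrow> f \<rho> \<ge> 1"
proof (induction rule: pos_fun.induct)
  case (mult f g)
  then show ?case using mult_mono[of 1 "f \<rho>" 1 "g \<rho>"] by simp
qed auto

lemma pos_fun_reindex: "f \<in> pos_fun \<Longrightarrow> (\<lambda>\<rho>. f (\<lambda>n. \<rho> (s n))) \<in> pos_fun"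
  by (induction rule: pos_fun.induct) (auto intro: pos_fun.intros simp del: of_nat_Suc)

text \<open>Integer polynomials in countably many variables, as functions of \<open>\<rho>\<close>; the value of the
  \<open>n\<close>-th variable is \<open>\<rho> n + 1\<close>, so that polynomials built without subtraction are positive.\<close>

definition zpoly_funs :: "((nat \<Rightarrow> nat) \<Rightarrow> int) set" where
  "zpoly_funs = {\<lambda>\<rho>. f \<rho> - g \<rho> | f g. f \<in> pos_fun \<and> g \<in> pos_fun}"

lemma zpoly_funsI: "f \<in> pos_fun \<Longrightarrow> g \<in> pos_fun \<Longrightarrow> (\<And>\<rho>. h \<rho> = f \<rho> - g \<rho>) \<Longrightarrow> h \<in> zpoly_funs"
  unfolding zpoly_funs_def by blast

lemma zpoly_funsE:
  assumes "h \<in> zpoly_funs"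
  obtains f g where "f \<in> pos_fun" "g \<in> pos_fun" "h = (\<lambda>\<rho>. f \<rho> - g \<rho>)"
  using assms unfolding zpoly_funs_def by blast

lemma zpoly_funs_zero: "(\<lambda>_. 0) \<in> zpoly_funs"
  by (rule zpoly_funsI[OF pos_fun.one pos_fun.one]) simp

lemma zpoly_funs_pos: "f \<in> pos_fun \<Longrightarrow> f \<in> zpoly_funs"
  by (rule zpoly_funsI[OF pos_fun.add[OF _ pos_fun.one] pos_fun.one]) auto

lemma zpoly_funs_minus: "f \<in> zpoly_funs \<Longrightarrow> (\<lambda>\<rho>. - f \<rho>) \<in> zpoly_funs"
  by (erule zpoly_funsE, rule zpoly_funsI) auto

lemma zpoly_funs_add:
  assumes "f \<in> zpoly_funs" "g \<in> zpoly_funs" shows "(\<lambda>\<rho>. f \<rho> + g \<rho>) \<in> zpoly_funs"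
proof -
  obtain a b where f: "a \<in> pos_fun" "b \<in> pos_fun" "f = (\<lambda>\<rho>. a \<rho> - b \<rho>)"
    using assms(1) by (rule zpoly_funsE)
  obtain c d where g: "c \<in> pos_fun" "d \<in> pos_fun" "g = (\<lambda>\<rho>. c \<rho> - d \<rho>)"
    using assms(2) by (rule zpoly_funsE)
  show ?thesis
    by (rule zpoly_funsI[OF pos_fun.add[OF f(1) g(1)] pos_fun.add[OF f(2) g(2)]]) (simp add: f g)
qed

lemma zpoly_funs_diff: "f \<in> zpoly_funs \<Longrightarrow> g \<in> zpoly_funs \<Longrightarrow> (\<lambda>\<rho>. f \<rho> - g \<rho>) \<in> zpoly_funs"
  using zpoly_funs_add[OF _ zpoly_funs_minus, of f g] by simp

lemma zpoly_funs_mult: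
  assumes "f \<in> zpoly_funs" "g \<in> zpoly_funs" shows "(\<lambda>\<rho>. f \<rho> * g \<rho>) \<in> zpoly_funs"
proof -
  obtain a b where f: "a \<in> pos_fun" "b \<in> pos_fun" "f = (\<lambda>\<rho>. a \<rho> - b \<rho>)"
    using assms(1) by (rule zpoly_funsE)
  obtain c d where g: "c \<in> pos_fun" "d \<in> pos_fun" "g = (\<lambda>\<rho>. c \<rho> - d \<rho>)"
    using assms(2) by (rule zpoly_funsE)
  show ?thesis
    by (rule zpoly_funsI[OF
          pos_fun.add[OF pos_fun.mult[OF f(1) g(1)] pos_fun.mult[OF f(2) g(2)]]
          pos_fun.add[OF pos_fun.mult[OF f(1) g(2)] pos_fun.mult[OF f(2) g(1)]]])
      (simp add: f g algebra_simps)
qed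

typedef zpoly = zpoly_funs morphisms eval Abs_zpoly
  using zpoly_funs_zero by blast

instantiation zpoly :: comm_ring_1
begin

definition "0 = Abs_zpoly (\<lambda>_. 0)"
definition "1 = Abs_zpoly (\<lambda>_. 1)"
definition "x + y = Abs_zpoly (\<lambda>\<rho>. eval x \<rho> + eval y \<rho>)"
definition "x * y = Abs_zpoly (\<lambda>\<rho>. eval x \<rho> * eval y \<rho>)"
definition "- x = Abs_zpoly (\<lambda>\<rho>. - eval x \<rho>)"
definition "x - y = Abs_zpoly (\<lambda>\<rho>. eval x \<rho> - eval y \<rho>)"

lemma eval_ring [simp]:
  "eval 0 \<rho> = 0" "eval 1 \<rho> = 1" "eval (x + y) \<rho> = eval x \<rho> + eval y \<rho>"
  "eval (x * y) \<rho> = eval x \<rho> * eval y \<rho>" "eval (- x) \<rho> = - eval x \<rho>"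
  "eval (x - y) \<rho> = eval x \<rho> - eval y \<rho>"
  by (simp_all add: zero_zpoly_def one_zpoly_def plus_zpoly_def times_zpoly_def uminus_zpoly_def
      minus_zpoly_def Abs_zpoly_inverse zpoly_funs_zero zpoly_funs_pos pos_fun.one
      zpoly_funs_minus zpoly_funs_add zpoly_funs_diff zpoly_funs_mult eval)

instance
proof
  show "(0::zpoly) \<noteq> 1" by (metis eval_ring(1,2) zero_neq_one)
qed (simp_all add: eval_inject[symmetric] fun_eq_iff algebra_simps)

end

definition cone :: "zpoly set" where "cone = {x. eval x \<in> pos_fun}"

lemma eval_Abs_pos: "f \<in> pos_fun \<Longrightarrow> eval (Abs_zpoly f) = f"
  by (simp add: Abs_zpoly_inverse zpoly_funs_pos)

lemma eval_ge_1: "x \<in> cone \<Longrightarrow> eval x \<rho> \<ge> 1"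
  by (simp add: cone_def pos_fun_ge_1)

interpretation cone: positive_cone cone
proof
  have ring: "eval 1 = (\<lambda>_. 1)" "eval (x + y) = (\<lambda>\<rho>. eval x \<rho> + eval y \<rho>)"
    "eval (x * y) = (\<lambda>\<rho>. eval x \<rho> * eval y \<rho>)" for x y by (simp_all add: fun_eq_iff)
  show "1 \<in> cone" using pos_fun.one by (simp add: cone_def ring)
  fix x y assume xy: "x \<in> cone" "y \<in> cone"
  show "x + y \<in> cone" "x * y \<in> cone"
    using xy pos_fun.add[of "eval x" "eval y"] pos_fun.mult[of "eval x" "eval y"]
    by (simp_all add: cone_def ring)
next
  fix x :: zpoly
  have "eval x \<in> zpoly_funs" by (rule eval)
  then obtain f g where fg: "f \<in> pos_fun" "g \<in> pos_fun" "eval x = (\<lambda>\<rho>. f \<rho> - g \<rho>)"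
    by (rule zpoly_funsE)
  have "x = Abs_zpoly f - Abs_zpoly g"
    by (simp add: eval_inject[symmetric] fun_eq_iff eval_Abs_pos fg)
  then show "\<exists>s\<in>cone. \<exists>t\<in>cone. x = s - t" using fg by (metis cone_def eval_Abs_pos mem_Collect_eq)
qed

lemma prod_cone: "(\<And>i. i \<in> I \<Longrightarrow> f i \<in> cone) \<Longrightarrow> prod f I \<in> cone"
  by (induction I rule: infinite_finite_induct) (auto intro: cone.one cone.mult)

section \<open>Evaluation at positive integers and a fresh variable\<close>

definition val :: "(nat \<Rightarrow> nat) \<Rightarrow> zpoly \<Rightarrow> nat" where "val \<rho> x = nat (eval x \<rho>)"

lemma val_1 [simp]: "val \<rho> 1 = 1"
  by (simp add: val_def)

lemma val_add: "x \<in> cone \<Longrightarrow> y \<in> cone \<Longrightarrow> val \<rho> (x + y) = val \<rho> x + val \<rho> y"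
  using eval_ge_1[of x \<rho>] eval_ge_1[of y \<rho>] by (simp add: val_def nat_add_distrib)

lemma val_mult: "x \<in> cone \<Longrightarrow> val \<rho> (x * y) = val \<rho> x * val \<rho> y"
  using eval_ge_1[of x \<rho>] by (simp add: val_def nat_mult_distrib)

lemma val_ge_1: "x \<in> cone \<Longrightarrow> val \<rho> x \<ge> 1"
  using eval_ge_1[of x \<rho>] by (simp add: val_def)

lemma int_val: "x \<in> cone \<Longrightarrow> int (val \<rho> x) = eval x \<rho>"
  using eval_ge_1[of x \<rho>] by (simp add: val_def)

definition var0 :: zpoly where "var0 = Abs_zpoly (\<lambda>\<rho>. int (Suc (\<rho> 0)))"

text \<open>Moves every variable up by one index, so that \<open>var0\<close> is fresh for each
  lifted polynomial.\<close>

definition lift :: "zpoly \<Rightarrow> zpoly" where "lift x = Abs_zpoly (\<lambda>\<rho>. eval x (\<lambda>n. \<rho> (Suc n)))"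

text \<open>Specialises variable 0 to \<open>v\<close> and undoes \<open>lift\<close>; for \<open>v \<in> cone\<close> the subtraction does not truncate.\<close>

definition substv :: "zpoly \<Rightarrow> (nat \<Rightarrow> nat) \<Rightarrow> nat \<Rightarrow> nat" where
  "substv v \<rho> = case_nat (val \<rho> v - 1) \<rho>"

lemma var0_cone: "var0 \<in> cone"
  using pos_fun.var by (simp add: cone_def var0_def eval_Abs_pos)

lemma lift_cone: "x \<in> cone \<Longrightarrow> lift x \<in> cone"
  using pos_fun_reindex[of "eval x" Suc] by (simp add: cone_def lift_def eval_Abs_pos)

lemma eval_var0_substv: "v \<in> cone \<Longrightarrow> eval var0 (substv v \<rho>) = eval v \<rho>"
  using pos_fun.var eval_ge_1[of v \<rho>] by (simp add: var0_def eval_Abs_pos substv_def val_def)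

lemma eval_lift_substv: "x \<in> cone \<Longrightarrow> eval (lift x) (substv v \<rho>) = eval x \<rho>"
  using pos_fun_reindex[of "eval x" Suc]
  by (simp add: cone_def lift_def eval_Abs_pos substv_def)

text \<open>Replacing variable 0 of \<open>y\<close> by \<open>v\<close> is polynomial in
  \<open>v\<close>, so polynomial recurrence can still find \<open>v\<close> after \<open>y\<close>
  has been fixed.\<close>

lemma substitution_poly:
  assumes "y \<in> cone"
  shows "\<exists>h. \<forall>v\<in>cone. poly h v \<in> cone \<and> (\<forall>\<rho>. eval (poly h v) \<rho> = eval y (substv v \<rho>))"
proof -
  have "\<exists>h. \<forall>v\<in>cone. poly h v \<in> cone \<and> (\<forall>\<rho>. eval (poly h v) \<rho> = f (substv v \<rho>))"
    if "f \<in> pos_fun" for f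
    using that
  proof (induction rule: pos_fun.induct)
    case one
    show ?case by (rule exI[of _ 1]) (use cone.one in auto)
  next
    case (var n)
    show ?case
    proof (cases n)
      case 0
      have "int (Suc (substv v \<rho> 0)) = eval v \<rho>" if "v \<in> cone" for v \<rho>
        using eval_ge_1[OF that, of \<rho>] by (simp add: substv_def val_def)
      then show ?thesis unfolding 0 by (intro exI[of _ "[:0, 1:]"]) auto
    next
      case (Suc m)
      have "Abs_zpoly (\<lambda>\<rho>. int (Suc (\<rho> m))) \<in> cone"
        using pos_fun.var[of m] by (simp add: cone_def eval_Abs_pos)
      moreover have "eval (Abs_zpoly (\<lambda>\<rho>. int (Suc (\<rho> m)))) \<rho> = int (Suc (substv v \<rho> n))" for v \<rho>
        using pos_fun.var[of m] by (simp add: Suc eval_Abs_pos substv_def)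
      ultimately show ?thesis
        by (intro exI[of _ "[:Abs_zpoly (\<lambda>\<rho>. int (Suc (\<rho> m))):]"]) auto
    qed
  next
    case (add f g)
    then obtain a b where "\<forall>v\<in>cone. poly a v \<in> cone \<and> (\<forall>\<rho>. eval (poly a v) \<rho> = f (substv v \<rho>))"
      "\<forall>v\<in>cone. poly b v \<in> cone \<and> (\<forall>\<rho>. eval (poly b v) \<rho> = g (substv v \<rho>))" by blast
    then show ?case by (intro exI[of _ "a + b"]) (auto intro: cone.add)
  next
    case (mult f g)
    then obtain a b where "\<forall>v\<in>cone. poly a v \<in> cone \<and> (\<forall>\<rho>. eval (poly a v) \<rho> = f (substv v \<rho>))"
      "\<forall>v\<in>cone. poly b v \<in> cone \<and> (\<forall>\<rho>. eval (poly b v) \<rho> = g (substv v \<rho>))" by blast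
    then show ?case by (intro exI[of _ "a * b"]) (auto intro: cone.mult)
  qed
  then show ?thesis using assms by (simp add: cone_def)
qed

section \<open>Scalable families and Moreira's argument\<close>

text \<open>Quantifying over all assignments makes the notion stable under specialising a variable
  to an element of \<open>cone\<close>.\<close>

definition good :: "nat set set \<Rightarrow> zpoly set \<Rightarrow> bool" where
  "good \<B> X \<longleftrightarrow> (\<forall>\<rho>. \<exists>B\<in>\<B>. B \<subseteq> val \<rho> ` X)"

text \<open>Under \<open>\<rho>\<close> the product \<open>c * v * g y\<close> takes the value of
  \<open>lift c * var0 * y\<close> under \<open>substv v \<rho>\<close>, and goodness covers that
  assignment too.\<close>

lemma good_substitute:
  assumes "good \<B> ((*) (lift c * var0) ` X)" "c \<in> cone" "v \<in> cone"
    and "\<And>y \<rho>. y \<in> X \<Longrightarrow> eval (g y) \<rho> = eval y (substv v \<rho>)"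
  shows "good \<B> ((\<lambda>y. c * v * g y) ` X)"
  unfolding good_def
proof
  fix \<rho>
  have "val (substv v \<rho>) (lift c * var0 * y) = val \<rho> (c * v * g y)" if "y \<in> X" for y
    using assms(4)[OF that] by (simp add: val_def eval_lift_substv[OF assms(2)] eval_var0_substv[OF assms(3)])
  then have "val (substv v \<rho>) ` ((*) (lift c * var0) ` X) = val \<rho> ` (\<lambda>y. c * v * g y) ` X"
    unfolding image_image by (intro image_cong) auto
  then show "\<exists>B\<in>\<B>. B \<subseteq> val \<rho> ` (\<lambda>y. c * v * g y) ` X"
    using assms(1) unfolding good_def by metis
qed

definition scalable :: "nat set set \<Rightarrow> bool" where
  "scalable \<B> \<longleftrightarrow> (\<forall>(r::nat) (\<chi>::zpoly \<Rightarrow> nat) C. (\<forall>x\<in>cone. \<chi> x < r) \<longrightarrow> finite C \<longrightarrow> C \<subseteq> cone \<longrightarrow>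
     (\<exists>X\<subseteq>cone. finite X \<and> X \<noteq> {} \<and> monochromatic \<chi> X \<and> (\<forall>c\<in>C. good \<B> ((*) c ` X))))"

text \<open>The multipliers are \<open>N * z\<close>, but the polynomials are evaluated at
  \<open>z\<close>: a pattern polynomial \<open>p(N z)\<close>, divided by a dilation factor, enters
  \<open>Q\<close> as a polynomial in \<open>z\<close>. Chains of every length replace an infinite
  set.\<close>

definition pattern_solution ::
  "nat set set \<Rightarrow> (zpoly \<Rightarrow> nat) \<Rightarrow> zpoly \<Rightarrow> zpoly poly set \<Rightarrow> zpoly set \<Rightarrow> zpoly set \<Rightarrow> nat \<Rightarrow> bool" where
  "pattern_solution \<B> \<chi> N Q A Z k \<longleftrightarrow> A \<subseteq> cone \<and> (\<forall>n. \<exists>a. cone.chain_in A n a) \<and>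
     Z \<subseteq> cone \<and> finite Z \<and> Z \<noteq> {} \<and> good \<B> ((*) N ` Z) \<and>
     (\<forall>a\<in>A. \<chi> a = k \<and> (\<forall>z\<in>Z. \<chi> (a * N * z) = k \<and>
        (\<forall>q\<in>Q. a + poly q z \<in> cone \<and> \<chi> (a + poly q z) = k)))"

definition pattern_ramsey :: "nat set set \<Rightarrow> bool" where
  "pattern_ramsey \<B> \<longleftrightarrow> (\<forall>(r::nat) \<chi> N Q. (\<forall>x\<in>cone. \<chi> x < r) \<longrightarrow> N \<in> cone \<longrightarrow> finite Q \<longrightarrow>
     (\<forall>q\<in>Q. coeff q 0 = 0) \<longrightarrow> (\<exists>A Z k. pattern_solution \<B> \<chi> N Q A Z k))"

text \<open>As \<open>q\<close> has no constant term, \<open>m\<close> can be factored out of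
  \<open>q(m z)\<close> as a polynomial in \<open>z\<close>.\<close>

lemma dilated_poly:
  fixes q :: "'a::comm_ring_1 poly"
  assumes "coeff q 0 = 0"
  shows "\<exists>q'. coeff q' 0 = 0 \<and> (\<forall>z. m * poly q' z = poly q (m * z))"
proof -
  obtain q0 where q: "q = pCons 0 q0" using assms by (cases q) auto
  show ?thesis
    by (rule exI[of _ "pCons 0 (pcompose q0 [:0, m:])"]) (simp add: q poly_pcompose ac_simps)
qed

text \<open>Compactness fixes a finite \<open>Y\<close> for all \<open>r\<close>-colourings at once.
  It can thus be chosen before the specialisation \<open>v\<close>, on which the colouring applied
  to it will depend.\<close>

lemma scalable_finite:
  assumes "scalable \<B>" "finite C" "C \<subseteq> cone"
  obtains Y where "finite Y" "Y \<subseteq> cone"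
    "\<And>\<chi>. (\<And>x. \<chi> x < (r::nat)) \<Longrightarrow>
      \<exists>X\<subseteq>Y. X \<noteq> {} \<and> monochromatic \<chi> X \<and> (\<forall>c\<in>C. good \<B> ((*) c ` X))"
proof -
  define \<F> where "\<F> = {X. X \<subseteq> cone \<and> finite X \<and> X \<noteq> {} \<and> (\<forall>c\<in>C. good \<B> ((*) c ` X))}"
  have 1: "finite F" if "F \<in> \<F>" for F using that by (simp add: \<F>_def)
  have 2: "\<exists>F\<in>\<F>. monochromatic \<chi> F" if "\<And>x. \<chi> x \<in> {..<r}" for \<chi>
  proof -
    have "\<forall>x\<in>cone. \<chi> x < r" using that by auto
    from assms(1)[unfolded scalable_def, THEN spec, THEN spec, THEN spec, THEN mp, OF this,
        THEN mp, OF assms(2), THEN mp, OF assms(3)]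
    show ?thesis unfolding \<F>_def by blast
  qed
  obtain \<G> where \<G>: "\<G> \<subseteq> \<F>" "finite \<G>"
    "\<And>\<chi>. (\<And>x. \<chi> x \<in> {..<r}) \<Longrightarrow> \<exists>F\<in>\<G>. monochromatic \<chi> F"
    using finite_ramsey_subfamily[OF finite_lessThan 1 2] by metis
  show thesis
  proof (rule that[of "\<Union>\<G>"])
    show "finite (\<Union>\<G>)" using \<G>(1,2) 1 by blast
    show "\<Union>\<G> \<subseteq> cone" using \<G>(1) by (auto simp: \<F>_def)
    fix \<chi> :: "zpoly \<Rightarrow> nat" assume "\<And>x. \<chi> x < r"
    then obtain F where "F \<in> \<G>" "monochromatic \<chi> F" using \<G>(3)[of \<chi>] by auto
    then show "\<exists>X\<subseteq>\<Union>\<G>. X \<noteq> {} \<and> monochromatic \<chi> X \<and> (\<forall>c\<in>C. good \<B> ((*) c ` X))"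
      using \<G>(1) by (intro exI[of _ F]) (auto simp: \<F>_def)
  qed
qed

text \<open>The colour-focusing argument of Moreira. In state \<open>(T, m, \<mu>, D)\<close> every \<open>x \<in> D\<close> has
  \<open>\<chi> (x * m t) = t\<close> for all \<open>t \<in> T\<close>, and all \<open>m t\<close> divide \<open>\<mu>\<close>. A fresh variable \<open>v\<close> is
  multiplied onto a finite set \<open>Y\<close> before it is specialised by polynomial recurrence; the new colour
  either lies in \<open>T\<close>, which gives a solution, or enlarges \<open>T\<close>.\<close>

lemma scalable_imp_pattern_ramsey:
  assumes scal: "scalable \<B>"
  shows "pattern_ramsey \<B>"
  unfolding pattern_ramsey_def
proof (intro allI impI)
  fix r :: nat and \<chi> :: "zpoly \<Rightarrow> nat" and N :: zpoly and Q :: "zpoly poly set"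
  assume \<chi>: "\<forall>x\<in>cone. \<chi> x < r" and N: "N \<in> cone" and Q: "finite Q" "\<forall>q\<in>Q. coeff q 0 = 0"
  note mult = cone.mult
  show "\<exists>A Z k. pattern_solution \<B> \<chi> N Q A Z k"
  proof (rule ccontr)
    assume neg: "\<not> ?thesis"
    have "\<exists>T m \<mu> D. card T = n \<and> T \<subseteq> {..<r} \<and> D \<subseteq> cone \<and> cone.large D \<and> \<mu> \<in> cone \<and>
        (\<forall>t\<in>T. m t \<in> cone \<and> (\<exists>u\<in>cone. \<mu> = m t * u) \<and> (\<forall>x\<in>D. \<chi> (x * m t) = t))" for n
    proof (induction n)
      case 0
      show ?case
        by (rule exI[of _ "{}"]) (use cone.large_cone cone.one in auto)
    next
      case (Suc n)
      then obtain T m \<mu> D where T: "card T = n" "T \<subseteq> {..<r}" and D: "D \<subseteq> cone" "cone.large D"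
        and \<mu>: "\<mu> \<in> cone" and m: "\<And>t. t \<in> T \<Longrightarrow> m t \<in> cone"
        and ex_u: "\<forall>t\<in>T. \<exists>u\<in>cone. \<mu> = m t * u"
        and col: "\<And>t x. t \<in> T \<Longrightarrow> x \<in> D \<Longrightarrow> \<chi> (x * m t) = t" by blast
      have finT: "finite T" using T(2) finite_subset by blast
      obtain u where u: "\<And>t. t \<in> T \<Longrightarrow> u t \<in> cone" "\<And>t. t \<in> T \<Longrightarrow> \<mu> = m t * u t"
        using ex_u by metis
      \<comment> \<open>Once \<open>var0\<close> is specialised to \<open>v\<close>, goodness of
        these dilates becomes goodness of \<open>N\<close> times the candidate \<open>Z\<close> for
        each colour \<open>t\<close> that may be repeated.\<close>
      define C where "C = (\<lambda>t. lift (N * u t * \<mu>) * var0) ` T"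
      have C: "finite C" "C \<subseteq> cone"
        using finT by (auto simp: C_def intro!: mult lift_cone var0_cone N u \<mu>)
      obtain Y where Y: "finite Y" "Y \<subseteq> cone" and mono: "\<And>\<chi>. (\<And>x. \<chi> x < r) \<Longrightarrow>
          \<exists>X\<subseteq>Y. X \<noteq> {} \<and> monochromatic \<chi> X \<and> (\<forall>c\<in>C. good \<B> ((*) c ` X))"
        using scalable_finite[OF scal C, where r = r] by blast
      obtain h where h: "\<And>y v. y \<in> Y \<Longrightarrow> v \<in> cone \<Longrightarrow> poly (h y) v \<in> cone"
        "\<And>y v \<rho>. y \<in> Y \<Longrightarrow> v \<in> cone \<Longrightarrow> eval (poly (h y) v) \<rho> = eval y (substv v \<rho>)"
      proof -
        have "\<forall>y\<in>Y. \<exists>h. \<forall>v\<in>cone. poly h v \<in> cone \<and> (\<forall>\<rho>. eval (poly h v) \<rho> = eval y (substv v \<rho>))"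
          using substitution_poly Y(2) by blast
        from bchoice[OF this] show thesis using that by blast
      qed
      have "\<forall>t. \<forall>q\<in>Q. \<exists>q'. coeff q' 0 = 0 \<and> (\<forall>z. m t * poly q' z = poly q (m t * z))"
        using dilated_poly Q(2) by blast
      then obtain d where d: "\<And>t q. q \<in> Q \<Longrightarrow> coeff (d t q) 0 = 0"
        "\<And>t q z. q \<in> Q \<Longrightarrow> m t * poly (d t q) z = poly q (m t * z)" by metis
      \<comment> \<open>For colour \<open>t\<close> the candidate
        \<open>z = u t * \<mu> * v * h(v)\<close> is \<open>m t\<close> times
        \<open>u t * u t * v * h(v)\<close>. Hence \<open>q(z)\<close> is \<open>m t\<close> times
        this polynomial at \<open>v\<close>; the factor \<open>v\<close> removes the constant
        term.\<close>
      define shift where "shift = (\<lambda>(t, q, y). pcompose (d t q) ([:0, u t * u t:] * h y))"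
      have shift: "poly (shift (t, q, y)) v = poly (d t q) (u t * u t * v * poly (h y) v)" for t q y v
        by (simp add: shift_def poly_pcompose ac_simps)
      have "\<forall>p\<in>shift ` (T \<times> Q \<times> Y). coeff p 0 = 0"
        using d(1) shift[where v = 0] by (auto simp: poly_0_coeff_0[symmetric] simp del: split_paired_All)
      moreover have "finite (shift ` (T \<times> Q \<times> Y))" using finT Q(1) Y(1) by blast
      ultimately obtain v where v: "v \<in> cone" and
        ret: "cone.large {x\<in>D. \<forall>p\<in>shift ` (T \<times> Q \<times> Y). x + poly p v \<in> D}"
        using cone.polynomial_recurrence[OF _ _ D(2)] by blast
      define D' where "D' = {x\<in>D. \<forall>p\<in>shift ` (T \<times> Q \<times> Y). x + poly p v \<in> D}"
      \<comment> \<open>For every \<open>t \<in> T\<close> at once this is \<open>m t * N\<close>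
        times the candidate \<open>z\<close> of \<open>t\<close>.\<close>
      define w where "w y = N * \<mu> * \<mu> * v * poly (h y) v" for y
      have w: "w y \<in> cone" if "y \<in> Y" for y
        unfolding w_def by (intro mult N \<mu> v h(1) that)
      define f where "f x = restrict (\<lambda>y. \<chi> (x * w y)) Y" for x
      have "f ` D' \<subseteq> Y \<rightarrow>\<^sub>E {..<r}"
        unfolding f_def D'_def using D(1) \<chi> w mult by (auto simp: restrict_PiE_iff)
      then have "finite (f ` D')" by (rule finite_subset) (simp add: Y(1) finite_PiE)
      then obtain g where g: "cone.large {x\<in>D'. f x = g}"
        using cone.large_colour_class[OF ret[folded D'_def]] by blast
      define D'' where "D'' = {x\<in>D'. f x = g}"
      have large: "cone.large D''" using g by (simp add: D''_def)
      have D''D: "x \<in> D" if "x \<in> D''" for x using that by (simp add: D''_def D'_def)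
      have D''shift: "x + poly (shift (t, q, y)) v \<in> D" if "x \<in> D''" "t \<in> T" "q \<in> Q" "y \<in> Y" for x t q y
        using that unfolding D''_def D'_def by blast
      have \<chi>g: "\<chi> (x * w y) = g y" if "x \<in> D''" "y \<in> Y" for x y
        using that unfolding D''_def f_def by (auto dest: fun_cong[of _ _ y])
      obtain x0 where x0: "x0 \<in> D''" using cone.large_nonempty[OF large] by blast
      have colr: "\<chi> (x * w y) < r" if "x \<in> D''" "y \<in> Y" for x y
        by (rule bspec[OF \<chi> mult[OF subsetD[OF D(1) D''D[OF that(1)]] w[OF that(2)]]])
      have g_less: "g y < r" if "y \<in> Y" for y
        using colr[OF x0 that] \<chi>g[OF x0 that] by simp
      have "0 < r" using bspec[OF \<chi> cone.one] by simp
      \<comment> \<open>The function \<open>g\<close> gives the colours on \<open>Y\<close>; the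
        default 0 is a legal colour because \<open>0 < r\<close>.\<close>
      define \<chi>' where "\<chi>' y = (if y \<in> Y then g y else 0)" for y
      have \<chi>'_less: "\<chi>' y < r" for y using g_less \<open>0 < r\<close> by (simp add: \<chi>'_def)
      from mono[of \<chi>', OF \<chi>'_less] obtain X where
        X: "X \<subseteq> Y" "X \<noteq> {}" "monochromatic \<chi>' X" "\<forall>c\<in>C. good \<B> ((*) c ` X)"
        by (elim exE conjE)
      obtain k where \<chi>'k: "\<forall>y\<in>X. \<chi>' y = k" using X(3) unfolding monochromatic_def by blast
      have k: "\<chi> (x * w y) = k" if "x \<in> D''" "y \<in> X" for x y
      proof -
        have "y \<in> Y" using that(2) X(1) by blast
        then show ?thesis using \<chi>g[OF that(1)] bspec[OF \<chi>'k that(2)] by (simp add: \<chi>'_def)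
      qed
      obtain y0 where y0: "y0 \<in> X" using X(2) by blast
      have "k < r" using k[OF x0 y0] colr[OF x0, of y0] X(1) y0 by auto
      \<comment> \<open>A repeated colour closes the pattern: the old multiplier \<open>m k\<close>
        gives \<open>a\<close>, the new one gives \<open>a * N * z\<close>, and recurrence gives
        \<open>a + q(z)\<close>.\<close>
      have "k \<notin> T"
      proof
        assume kT: "k \<in> T"
        define A where "A = (\<lambda>x. x * m k) ` D''"
        define Z where "Z = (\<lambda>y. u k * \<mu> * v * poly (h y) v) ` X"
        have "pattern_solution \<B> \<chi> N Q A Z k"
          unfolding pattern_solution_def
        proof (intro conjI allI ballI)
          show "A \<subseteq> cone" by (auto simp: A_def intro: mult[OF subsetD[OF D(1) D''D] m[OF kT]])
          show "\<exists>a. cone.chain_in A n a" for n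
            using cone.large_chain[OF large] cone.chain_in_mult[OF _ m[OF kT]] unfolding A_def by blast
          show "Z \<subseteq> cone" by (auto simp: Z_def intro!: mult u(1)[OF kT] \<mu> v h(1) subsetD[OF X(1)])
          show "finite Z" unfolding Z_def by (intro finite_imageI finite_subset[OF X(1) Y(1)])
          show "Z \<noteq> {}" unfolding Z_def using X(2) by blast
          have "good \<B> ((\<lambda>y. (N * u k * \<mu>) * v * poly (h y) v) ` X)"
          proof (rule good_substitute)
            show "good \<B> ((*) (lift (N * u k * \<mu>) * var0) ` X)" by (rule bspec[OF X(4)]) (simp add: C_def kT)
            show "N * u k * \<mu> \<in> cone" by (intro mult N u(1)[OF kT] \<mu>)
            show "v \<in> cone" by (rule v)
            show "eval (poly (h y) v) \<rho> = eval y (substv v \<rho>)" if "y \<in> X" for y \<rho>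
              using h(2)[OF _ v] that X(1) by blast
          qed
          then show "good \<B> ((*) N ` Z)" by (simp add: Z_def image_image mult.assoc)
        next
          fix a assume "a \<in> A"
          then obtain x where x: "x \<in> D''" "a = x * m k" unfolding A_def by blast
          show "\<chi> a = k" using col[OF kT D''D[OF x(1)]] x(2) by simp
          fix z assume "z \<in> Z"
          then obtain y where y: "y \<in> X" "z = u k * \<mu> * v * poly (h y) v" unfolding Z_def by blast
          have "a * N * z = x * (N * (m k * u k) * \<mu> * v * poly (h y) v)"
            by (simp add: x(2) y(2) ac_simps)
          also have "\<dots> = x * w y" unfolding w_def u(2)[OF kT, symmetric] by simp
          finally show "\<chi> (a * N * z) = k" using k[OF x(1) y(1)] by simp
          fix q assume q: "q \<in> Q"
          have "u k * \<mu> * v * poly (h y) v = m k * (u k * u k * v * poly (h y) v)"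
            by (subst u(2)[OF kT]) (simp add: ac_simps)
          then have "poly q z = m k * poly (shift (k, q, y)) v"
            unfolding y(2) shift using d(2)[OF q] by simp
          then have eq: "a + poly q z = (x + poly (shift (k, q, y)) v) * m k"
            by (simp add: x(2) algebra_simps)
          have "x + poly (shift (k, q, y)) v \<in> D" using D''shift[OF x(1) kT q] y(1) X(1) by blast
          then show "a + poly q z \<in> cone" "\<chi> (a + poly q z) = k"
            unfolding eq by (rule mult[OF subsetD[OF D(1)] m[OF kT]], rule col[OF kT])
        qed
        then show False using neg by blast
      qed
      \<comment> \<open>The value \<open>w y0\<close> becomes both the multiplier of the new colour
        and the new common multiple.\<close>
      have "\<exists>z\<in>cone. w y0 = m t * z" if t: "t \<in> T" for t
      proof
        show "w y0 = m t * (N * u t * \<mu> * v * poly (h y0) v)"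
          unfolding w_def by (subst (1) u(2)[OF t]) (simp add: ac_simps)
        show "N * u t * \<mu> * v * poly (h y0) v \<in> cone"
          using X(1) y0 by (intro mult N u(1)[OF t] \<mu> v h(1)) auto
      qed
      moreover have "\<exists>z\<in>cone. w y0 = w y0 * z" using cone.one by (intro bexI[of _ 1]) auto
      moreover have "w y0 \<in> cone" using w X(1) y0 by blast
      moreover have "D'' \<subseteq> cone" using D(1) D''D by blast
      ultimately show ?case
        using T finT \<open>k \<notin> T\<close> \<open>k < r\<close> large m k[OF _ y0] col D''D
        by (intro exI[of _ "insert k T"] exI[of _ "m(k := w y0)"] exI[of _ "w y0"] exI[of _ D'']) auto
    qed
    from this[of "Suc r"] obtain T where "card T = Suc r" "T \<subseteq> {..<r}" by blast
    then show False using card_mono[of "{..<r}" T] by simp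
  qed
qed

lemma ramsey_familyD:
  fixes c :: "nat \<Rightarrow> nat"
  assumes "ramsey_family \<B>" "r \<ge> 1" "c ` {1..} \<subseteq> {1..r}"
  obtains B i where "B \<in> \<B>" "\<forall>x\<in>B. c x = i"
  using assms(1)[unfolded ramsey_family_def, THEN conjunct2, rule_format, OF assms(2,3)] by blast

lemma pattern_ramseyD:
  assumes "pattern_ramsey \<B>" "\<forall>x\<in>cone. \<chi> x < r" "N \<in> cone" "finite Q" "\<forall>q\<in>Q. coeff q 0 = 0"
  obtains A Z k where "pattern_solution \<B> \<chi> N Q A Z k"
  using assms(1)[unfolded pattern_ramsey_def, THEN spec, THEN spec, THEN spec, THEN spec, THEN mp,
      OF assms(2), THEN mp, OF assms(3), THEN mp, OF assms(4), THEN mp, OF assms(5)]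
  by (elim exE) (rule that)

section \<open>Linear Rado families\<close>

lemma eval_of_nat [simp]: "eval (of_nat n) \<rho> = int n"
  by (induction n) auto

lemma of_nat_cone: "n \<ge> 1 \<Longrightarrow> of_nat n \<in> cone"
  by (induction n rule: dec_induct) (auto intro: cone.one cone.add)

lemma linear_solutions_scale:
  assumes "B \<in> linear_solutions l k M" "c \<ge> 1"
  shows "(*) c ` B \<in> linear_solutions l k M"
proof -
  obtain x where B: "B = x ` {1..k}" and pos: "\<forall>j\<in>{1..k}. x j \<ge> 1"
    and sol: "\<forall>i\<in>{1..l}. (\<Sum>j=1..k. M i j * int (x j)) = 0"
    using assms(1) unfolding linear_solutions_def by blast
  have "(\<Sum>j=1..k. M i j * int (c * x j)) = int c * (\<Sum>j=1..k. M i j * int (x j))" for i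
    by (simp add: sum_distrib_left ac_simps)
  then have "\<forall>i\<in>{1..l}. (\<Sum>j=1..k. M i j * int (c * x j)) = 0" using sol by simp
  moreover have "\<forall>j\<in>{1..k}. c * x j \<ge> 1" using pos assms(2) by (simp add: Suc_le_eq)
  ultimately show ?thesis
    unfolding linear_solutions_def B by (intro CollectI exI[of _ "\<lambda>j. c * x j"]) (auto simp: image_image)
qed

text \<open>Constants suffice: the colouring of the positive integers has a monochromatic solution
  set, and after evaluation a dilation by \<open>c\<close> multiplies it by the positive integer
  \<open>val \<rho> c\<close>, which preserves homogeneous linear equations.\<close>

lemma linear_rado_scalable:
  assumes "linear_rado_family \<B>" shows "scalable \<B>"
  unfolding scalable_def
proof (intro allI impI)
  obtain l k M where k: "k \<ge> 1" and \<B>: "\<B> = linear_solutions l k M" and ramsey: "ramsey_family \<B>"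
    using assms unfolding linear_rado_family_def by blast
  fix r :: nat and \<chi> :: "zpoly \<Rightarrow> nat" and C
  assume \<chi>: "\<forall>x\<in>cone. \<chi> x < r" and C: "finite C" "C \<subseteq> cone"
  have "r \<ge> 1" using bspec[OF \<chi> cone.one] by simp
  moreover have "(\<lambda>n. Suc (\<chi> (of_nat n))) ` {1..} \<subseteq> {1..r}"
    using \<chi> of_nat_cone by (auto simp: Suc_le_eq)
  ultimately obtain B i where B: "B \<in> \<B>" "\<forall>n\<in>B. Suc (\<chi> (of_nat n)) = i"
    using ramsey_familyD[OF ramsey] by blast
  then have fin: "finite B" and ne: "B \<noteq> {}" and pos: "\<forall>n\<in>B. n \<ge> 1"
    using k unfolding \<B> linear_solutions_def by auto
  have "good \<B> ((*) c ` of_nat ` B)" if "c \<in> C" for c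
    unfolding good_def
  proof
    fix \<rho>
    have c: "c \<in> cone" using that C(2) by blast
    have "val \<rho> ` (*) c ` of_nat ` B = (*) (val \<rho> c) ` B"
      unfolding image_image val_mult[OF c] by (simp add: val_def)
    then show "\<exists>B'\<in>\<B>. B' \<subseteq> val \<rho> ` (*) c ` of_nat ` B"
      using linear_solutions_scale[OF B(1)[unfolded \<B>] val_ge_1[OF c]] unfolding \<B> by (metis order_refl)
  qed
  moreover have "monochromatic \<chi> (of_nat ` B)"
    unfolding monochromatic_def by (rule exI[of _ "i - 1"]) (use B(2) in auto)
  ultimately show "\<exists>X\<subseteq>cone. finite X \<and> X \<noteq> {} \<and> monochromatic \<chi> X \<and> (\<forall>c\<in>C. good \<B> ((*) c ` X))"
    using fin ne pos of_nat_cone by (intro exI[of _ "of_nat ` B"]) auto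
qed

section \<open>From pattern solutions in the cone to patterns of integers\<close>

lemma eval_poly_of_nat:
  assumes "x \<in> cone"
  shows "eval (poly (map_poly of_nat p) x) \<rho> = int (poly p (val \<rho> x))"
  by (induction p) (auto simp: map_poly_pCons int_val[OF assms])

text \<open>Elements of \<open>cone\<close> have value at least 1, so values increase strictly along
  a chain.\<close>

lemma chain_val_inj:
  assumes "cone.chain_in A n a" "A \<subseteq> cone" "c \<in> cone"
  shows "inj_on (\<lambda>i. val \<rho> (c * a i)) {..<n}"
proof -
  have "val \<rho> (c * a j) < val \<rho> (c * a i)" if "i < n" "j < i" for i j
  proof -
    have aj: "a j \<in> cone" and s: "a i - a j \<in> cone"
      using assms that unfolding cone.chain_in_def by auto
    have "val \<rho> (a i) = val \<rho> (a j) + val \<rho> (a i - a j)" using val_add[OF aj s] by simp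
    then show ?thesis using val_ge_1[OF s, of \<rho>] val_ge_1[OF assms(3), of \<rho>] by (simp add: val_mult[OF assms(3)])
  qed
  then show ?thesis by (intro linorder_inj_onI') (metis lessThan_iff less_irrefl)
qed

text \<open>The elements \<open>c a\<close>, \<open>c a * N z\<close> and
  \<open>c a + p(N z)\<close> are \<open>c\<close> times \<open>a\<close>, \<open>a * N * z\<close>
  and \<open>a + q(z)\<close>. This serves finite patterns under all dilations, and infinite ones
  with \<open>c = N = 1\<close>.\<close>

lemma poly_pattern_subset:
  assumes cone: "A \<subseteq> cone" "c \<in> cone" "N \<in> cone" "Z \<subseteq> cone"
    and B: "B \<subseteq> val \<rho> ` (*) N ` Z"
    and Q: "\<And>p. p \<in> P \<Longrightarrow> \<exists>q\<in>Q. \<forall>z. c * poly q z = poly (map_poly of_nat p) (N * z)"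
  shows "poly_pattern P (val \<rho> ` (*) c ` A) B \<subseteq>
    val \<rho> ` (*) c ` (A \<union> {a * N * z | a z. a \<in> A \<and> z \<in> Z} \<union> {a + poly q z | a z q. a \<in> A \<and> z \<in> Z \<and> q \<in> Q})"
    (is "_ \<subseteq> val \<rho> ` (*) c ` ?X")
proof
  fix s assume "s \<in> poly_pattern P (val \<rho> ` (*) c ` A) B"
  then consider "s \<in> val \<rho> ` (*) c ` A"
    | a b where "a \<in> A" "b \<in> B" "s = val \<rho> (c * a) * b"
    | a b p where "a \<in> A" "b \<in> B" "p \<in> P" "s = val \<rho> (c * a) + poly p b"
    unfolding poly_pattern_def by blast
  then show "s \<in> val \<rho> ` (*) c ` ?X"
  proof cases
    case 1
    then show ?thesis by blast
  next
    case 2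
    then obtain z where z: "z \<in> Z" "b = val \<rho> (N * z)" using B by blast
    have "c * a \<in> cone" using 2(1) cone cone.mult by blast
    then have "s = val \<rho> (c * (a * N * z))" by (simp add: 2(3) z(2) val_mult[symmetric] mult.assoc)
    then show ?thesis using 2(1) z(1) by blast
  next
    case 3
    then obtain z where z: "z \<in> Z" "b = val \<rho> (N * z)" using B by blast
    obtain q where q: "q \<in> Q" "\<And>z. c * poly q z = poly (map_poly of_nat p) (N * z)"
      using Q[OF 3(3)] by blast
    have ca: "c * a \<in> cone" and Nz: "N * z \<in> cone" using 3(1) z(1) cone cone.mult by blast+
    have "c * (a + poly q z) = c * a + poly (map_poly of_nat p) (N * z)"
      by (simp add: distrib_left q(2))
    then have "eval (c * (a + poly q z)) \<rho> = int s"
      by (simp only: eval_ring(3) eval_poly_of_nat[OF Nz] int_val[OF ca, symmetric] 3(4) z(2) of_nat_add)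
    then have "s = val \<rho> (c * (a + poly q z))" by (simp add: val_def)
    then show ?thesis using 3(1) z(1) q(1) by blast
  qed
qed

text \<open>The product \<open>N\<close> of all dilations is divisible by each \<open>c\<close>, so
  \<open>p(N z) = c q(z)\<close> for some \<open>q\<close> without constant term. One pattern
  solution for \<open>N\<close> then yields patterns under all dilations simultaneously, a chain of
  length \<open>m\<close> supplying the set of \<open>m\<close> integers.\<close>

lemma pattern_ramsey_imp_scalable:
  assumes ramsey: "pattern_ramsey \<B>" and P: "finite P" "\<forall>p\<in>P. integral_poly p" and m: "m \<ge> 1"
  shows "scalable (finite_pattern_family P m \<B>)"
  unfolding scalable_def
proof (intro allI impI)
  fix r :: nat and \<chi> :: "zpoly \<Rightarrow> nat" and C
  assume \<chi>: "\<forall>x\<in>cone. \<chi> x < r" and C: "finite C" "C \<subseteq> cone"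
  define N where "N = \<Prod>C"
  have N: "N \<in> cone" unfolding N_def using C(2) by (blast intro: prod_cone)
  have "\<exists>q. coeff q 0 = 0 \<and> (\<forall>z. c * poly q z = poly (map_poly of_nat p) (N * z))"
    if "p \<in> P" "c \<in> C" for p c
  proof -
    have "coeff (map_poly of_nat p :: zpoly poly) 0 = 0"
      using P(2) that(1) by (simp add: integral_poly_def coeff_map_poly)
    then obtain q where q: "coeff q 0 = 0" "\<And>z. N * poly q z = poly (map_poly of_nat p) (N * z)"
      using dilated_poly by blast
    have "N = c * \<Prod>(C - {c})" unfolding N_def using prod.remove[OF C(1) that(2)] by simp
    then have "c * poly (smult (\<Prod>(C - {c})) q) z = N * poly q z" for z by (simp add: mult.assoc)
    then show ?thesis using q by (intro exI[of _ "smult (\<Prod>(C - {c})) q"]) simp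
  qed
  then obtain d where d: "\<And>p c. p \<in> P \<Longrightarrow> c \<in> C \<Longrightarrow> coeff (d p c) 0 = 0"
    "\<And>p c z. p \<in> P \<Longrightarrow> c \<in> C \<Longrightarrow> c * poly (d p c) z = poly (map_poly of_nat p) (N * z)" by metis
  define Q where "Q = (\<lambda>(p, c). d p c) ` (P \<times> C)"
  have Q: "finite Q" "\<forall>q\<in>Q. coeff q 0 = 0" using P(1) C(1) d(1) by (auto simp: Q_def)
  obtain A Z k where sol: "pattern_solution \<B> \<chi> N Q A Z k"
    by (rule pattern_ramseyD[OF ramsey \<chi> N Q])
  have A: "A \<subseteq> cone" and Z: "Z \<subseteq> cone" "finite Z" and goodZ: "good \<B> ((*) N ` Z)"
    using sol unfolding pattern_solution_def by blast+
  obtain a where a: "cone.chain_in A m a" using sol unfolding pattern_solution_def by blast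
  define A0 where "A0 = a ` {..<m}"
  have A0: "A0 \<subseteq> A" using a unfolding A0_def cone.chain_in_def by auto
  have fin: "finite A0" "A0 \<noteq> {}" using m by (auto simp: A0_def lessThan_empty_iff)
  define X where "X = A0 \<union> {a * N * z | a z. a \<in> A0 \<and> z \<in> Z} \<union>
    {a + poly q z | a z q. a \<in> A0 \<and> z \<in> Z \<and> q \<in> Q}"
  have "X = A0 \<union> (\<Union>a\<in>A0. \<Union>z\<in>Z. {a * N * z}) \<union> (\<Union>a\<in>A0. \<Union>z\<in>Z. \<Union>q\<in>Q. {a + poly q z})"
    unfolding X_def by blast
  then have "finite X" using fin Z(2) Q(1) by simp
  moreover have "X \<noteq> {}" using fin by (auto simp: X_def)
  moreover have "x \<in> cone \<and> \<chi> x = k" if "x \<in> X" for x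
  proof -
    have "a * N * z \<in> cone" if "a \<in> A0" "z \<in> Z" for a z
      by (intro cone.mult N) (use that A0 A Z in auto)
    then show ?thesis
      using that sol A0 A unfolding X_def pattern_solution_def by blast
  qed
  then have "X \<subseteq> cone" "monochromatic \<chi> X" by (auto simp: monochromatic_def)
  moreover have "good (finite_pattern_family P m \<B>) ((*) c ` X)" if c: "c \<in> C" for c
    unfolding good_def
  proof
    fix \<rho>
    have c': "c \<in> cone" using c C(2) by blast
    obtain B where B: "B \<in> \<B>" "B \<subseteq> val \<rho> ` (*) N ` Z" using goodZ unfolding good_def by blast
    let ?A = "val \<rho> ` (*) c ` A0"
    have "?A = (\<lambda>i. val \<rho> (c * a i)) ` {..<m}" by (simp add: A0_def image_image)
    then have "card ?A = m" using card_image[OF chain_val_inj[OF a A c']] by simp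
    moreover have "?A \<subseteq> {1..}" using A0 A c' val_ge_1 cone.mult by fastforce
    ultimately have "?A \<in> nsets {1..} m" using fin by (simp add: nsets_def)
    moreover have "poly_pattern P ?A B \<subseteq> val \<rho> ` (*) c ` X"
      unfolding X_def
    proof (rule poly_pattern_subset[OF _ c' N Z(1) B(2)])
      show "A0 \<subseteq> cone" using A0 A by blast
      show "\<exists>q\<in>Q. \<forall>z. c * poly q z = poly (map_poly of_nat p) (N * z)" if "p \<in> P" for p
        by (rule bexI[of _ "d p c"]) (use d(2) that c in \<open>auto simp: Q_def\<close>)
    qed
    ultimately show "\<exists>B\<in>finite_pattern_family P m \<B>. B \<subseteq> val \<rho> ` (*) c ` X"
      unfolding finite_pattern_family_def using B(1) by blast
  qed
  ultimately show "\<exists>X\<subseteq>cone. finite X \<and> X \<noteq> {} \<and> monochromatic \<chi> X \<and>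
      (\<forall>c\<in>C. good (finite_pattern_family P m \<B>) ((*) c ` X))" by blast
qed

lemma poly_pattern_pos: "A \<subseteq> {1..} \<Longrightarrow> B \<subseteq> {1..} \<Longrightarrow> poly_pattern P A B \<subseteq> {1..}"
  unfolding poly_pattern_def by (auto simp: Suc_le_eq subset_iff)

lemma pattern_ramsey_imp_infinite:
  assumes ramsey: "pattern_ramsey \<B>" and \<B>: "\<B> \<subseteq> Pow {1..}"
    and P: "finite P" "\<forall>p\<in>P. integral_poly p"
  shows "ramsey_family (infinite_pattern_family P \<B>)"
  unfolding ramsey_family_def
proof (intro conjI allI impI)
  show "infinite_pattern_family P \<B> \<subseteq> Pow {1..}"
    unfolding infinite_pattern_family_def using poly_pattern_pos \<B> by blast
  fix r :: nat and c :: "nat \<Rightarrow> nat" assume c: "c ` {1..} \<subseteq> {1..r}"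
  \<comment> \<open>All variables take the value 1, since \<open>\<rho> n\<close> encodes the value
    \<open>\<rho> n + 1\<close>.\<close>
  define \<rho> :: "nat \<Rightarrow> nat" where "\<rho> = (\<lambda>_. 0)"
  define Q where "Q = (map_poly of_nat ` P :: zpoly poly set)"
  have col: "\<forall>x\<in>cone. c (val \<rho> x) < Suc r"
    using c val_ge_1[of _ \<rho>] by (auto simp: image_subset_iff less_Suc_eq_le)
  have Q: "finite Q" "\<forall>q\<in>Q. coeff q 0 = 0"
    using P by (auto simp: Q_def integral_poly_def coeff_map_poly)
  obtain A Z k where sol: "pattern_solution \<B> (\<lambda>x. c (val \<rho> x)) 1 Q A Z k"
    by (rule pattern_ramseyD[OF ramsey col cone.one Q])
  have A: "A \<subseteq> cone" and Z: "Z \<subseteq> cone" and goodZ: "good \<B> ((*) 1 ` Z)"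
    using sol unfolding pattern_solution_def by blast+
  obtain B where B: "B \<in> \<B>" "B \<subseteq> val \<rho> ` (*) 1 ` Z" using goodZ unfolding good_def by blast
  let ?A = "val \<rho> ` (*) 1 ` A"
  have "?A \<subseteq> {1..}" using A val_ge_1 by auto
  moreover have "infinite ?A"
  proof
    assume fin: "finite ?A"
    obtain a where a: "cone.chain_in A (Suc (card ?A)) a"
      using sol unfolding pattern_solution_def by blast
    have "(\<lambda>i. val \<rho> (1 * a i)) ` {..<Suc (card ?A)} \<subseteq> ?A"
      using a unfolding cone.chain_in_def by auto
    from card_mono[OF fin this] show False
      unfolding card_image[OF chain_val_inj[OF a A cone.one]] by simp
  qed
  ultimately have "poly_pattern P ?A B \<in> infinite_pattern_family P \<B>"
    unfolding infinite_pattern_family_def using B(1) by blast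
  moreover have "poly_pattern P ?A B \<subseteq> val \<rho> ` (*) 1 `
      (A \<union> {a * 1 * z | a z. a \<in> A \<and> z \<in> Z} \<union> {a + poly q z | a z q. a \<in> A \<and> z \<in> Z \<and> q \<in> Q})"
    by (rule poly_pattern_subset[OF A cone.one cone.one Z B(2)]) (auto simp: Q_def)
  then have "\<forall>x\<in>poly_pattern P ?A B. c x = k"
    using sol unfolding pattern_solution_def by auto
  ultimately show "\<exists>B\<in>infinite_pattern_family P \<B>. \<exists>i. \<forall>x\<in>B. c x = i" by blast
qed

lemma rado_tower_pos: "\<B> \<in> rado_tower \<Longrightarrow> \<B> \<subseteq> Pow {1..}"
proof (induction rule: rado_tower.induct)
  case (linear \<B>)
  then show ?case unfolding linear_rado_family_def ramsey_family_def by blast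
next
  case (geometric \<B>)
  then show ?case unfolding geometric_rado_family_def geometric_solutions_def by fastforce
next
  case (pattern \<B> P m)
  then show ?case
    unfolding finite_pattern_family_def nsets_def using poly_pattern_pos by blast
qed

section \<open>Geometric Rado families\<close>

definition linear_solution :: "nat \<Rightarrow> nat \<Rightarrow> (nat \<Rightarrow> nat \<Rightarrow> int) \<Rightarrow> (nat \<Rightarrow> nat) \<Rightarrow> bool" where
  "linear_solution l k M x \<longleftrightarrow>
     (\<forall>j\<in>{1..k}. x j \<ge> 1) \<and> (\<forall>i\<in>{1..l}. (\<Sum>j=1..k. M i j * int (x j)) = 0)"

lemma linear_solutions_alt: "linear_solutions l k M = {x ` {1..k} | x. linear_solution l k M x}"
  unfolding linear_solutions_def linear_solution_def by blast

text \<open>Compactness bounds the solutions by one \<open>L\<close>. The colours may have any type,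
  because later a colour is itself a function on words.\<close>

lemma ramsey_family_finite:
  fixes K :: "'c set"
  assumes ramsey: "ramsey_family (linear_solutions l k M)" and K: "finite K"
  shows "\<exists>L. \<forall>\<chi>. (\<forall>x. \<chi> x \<in> K) \<longrightarrow>
    (\<exists>x. linear_solution l k M x \<and> x ` {1..k} \<subseteq> {1..L} \<and> monochromatic \<chi> (x ` {1..k}))"
proof -
  let ?\<F> = "linear_solutions l k M"
  obtain h where h: "bij_betw h K {0..<card K}" using ex_bij_betw_finite_nat[OF K] by blast
  have 1: "finite F" if "F \<in> ?\<F>" for F using that by (auto simp: linear_solutions_def)
  have 2: "\<exists>F\<in>?\<F>. monochromatic \<chi> F" if \<chi>: "\<And>x. \<chi> x \<in> K" for \<chi> :: "nat \<Rightarrow> 'c"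
  proof -
    have less: "h (\<chi> x) < card K" for x using bij_betwE[OF h] \<chi> by force
    then have "(\<lambda>x. Suc (h (\<chi> x))) ` {1..} \<subseteq> {1..card K}" by (auto simp: Suc_le_eq)
    moreover have "card K \<ge> 1" using less[of 0] by simp
    ultimately obtain B i where B: "B \<in> ?\<F>" "\<forall>x\<in>B. Suc (h (\<chi> x)) = i"
      using ramsey_familyD[OF ramsey] by blast
    have "\<chi> x = \<chi> y" if "x \<in> B" "y \<in> B" for x y
    proof (rule inj_onD[OF bij_betw_imp_inj_on[OF h] _ \<chi> \<chi>])
      show "h (\<chi> x) = h (\<chi> y)" using bspec[OF B(2) that(1)] bspec[OF B(2) that(2)] by simp
    qed
    then have "monochromatic \<chi> B" by (rule monochromaticI)
    then show ?thesis using B(1) by blast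
  qed
  obtain \<G> where \<G>: "\<G> \<subseteq> ?\<F>" "finite \<G>"
    "\<And>\<chi>. (\<And>x. \<chi> x \<in> K) \<Longrightarrow> \<exists>F\<in>\<G>. monochromatic \<chi> F"
  proof (rule finite_ramsey_subfamily[of K ?\<F>])
    show "\<exists>F\<in>?\<F>. monochromatic \<chi> F" if "\<And>x. \<chi> x \<in> K" for \<chi> by (rule 2[OF that])
  qed (use K 1 that in blast)+
  have fin: "finite (\<Union>\<G>)" using \<G>(1,2) 1 by blast
  show ?thesis
  proof (intro exI[of _ "Max (\<Union>\<G>)"] allI impI)
    fix \<chi> :: "nat \<Rightarrow> 'c" assume "\<forall>x. \<chi> x \<in> K"
    then obtain F where F: "F \<in> \<G>" "monochromatic \<chi> F" using \<G>(3)[of \<chi>] by blast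
    then obtain x where x: "F = x ` {1..k}" "linear_solution l k M x"
      using \<G>(1) unfolding linear_solutions_alt by blast
    have "x ` {1..k} \<subseteq> {1..Max (\<Union>\<G>)}"
    proof
      fix y assume y: "y \<in> x ` {1..k}"
      then have "y \<in> \<Union>\<G>" using F(1) x(1) by blast
      moreover have "y \<ge> 1" using y x(2) unfolding linear_solution_def by auto
      ultimately show "y \<in> {1..Max (\<Union>\<G>)}" using Max_ge[OF fin] by simp
    qed
    then show "\<exists>x. linear_solution l k M x \<and> x ` {1..k} \<subseteq> {1..Max (\<Union>\<G>)} \<and> monochromatic \<chi> (x ` {1..k})"
      using x F(2) by blast
  qed
qed

definition words :: "nat \<Rightarrow> (nat \<Rightarrow> nat set) \<Rightarrow> (nat \<Rightarrow> nat) set" where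
  "words n X = {w. (\<forall>i<n. w i \<in> X i) \<and> (\<forall>i\<ge>n. w i = 0)}"

lemma finite_words: "finite (words n (\<lambda>_. {1..L}))"
proof -
  have "words n (\<lambda>_. {1..L}) = {w. \<forall>i. (i \<in> {..<n} \<longrightarrow> w i \<in> {1..L}) \<and> (i \<notin> {..<n} \<longrightarrow> w i = 0)}"
    unfolding words_def by (auto simp: not_less)
  then show ?thesis using finite_set_of_finite_funs[of "{..<n}" "{1..L}" 0] by simp
qed

text \<open>Induction on \<open>n\<close>: the last letter is coloured by the whole function that it
  induces on words of length \<open>n\<close> with letters up to \<open>L1\<close>. A monochromatic
  solution makes the colour independent of the last letter, which is then frozen while the induction
  hypothesis handles the others.\<close>

lemma ramsey_words:
  fixes K :: "'c set"
  assumes ramsey: "ramsey_family (linear_solutions l k M)" and k: "k \<ge> 1" and K: "finite K"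
  shows "\<exists>L. \<forall>\<kappa>. (\<forall>w. \<kappa> w \<in> K) \<longrightarrow>
    (\<exists>\<beta>. (\<forall>i<n. linear_solution l k M (\<beta> i) \<and> \<beta> i ` {1..k} \<subseteq> {1..L}) \<and>
      monochromatic \<kappa> (words n (\<lambda>i. \<beta> i ` {1..k})))"
proof (induction n)
  case 0
  have "words 0 X = {\<lambda>_. 0}" for X by (auto simp: words_def)
  then show ?case by (auto simp: monochromatic_def)
next
  case (Suc n)
  then obtain L1 where L1: "\<forall>\<kappa>. (\<forall>w. \<kappa> w \<in> K) \<longrightarrow>
    (\<exists>\<beta>. (\<forall>i<n. linear_solution l k M (\<beta> i) \<and> \<beta> i ` {1..k} \<subseteq> {1..L1}) \<and>
      monochromatic \<kappa> (words n (\<lambda>i. \<beta> i ` {1..k})))" by (elim exE)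
  define W where "W = words n (\<lambda>_. {1..L1})"
  have "finite (W \<rightarrow>\<^sub>E K)" using K finite_words unfolding W_def by (intro finite_PiE) auto
  from ramsey_family_finite[OF ramsey this] obtain L2 where L2: "\<forall>\<chi>. (\<forall>x. \<chi> x \<in> W \<rightarrow>\<^sub>E K) \<longrightarrow>
    (\<exists>x. linear_solution l k M x \<and> x ` {1..k} \<subseteq> {1..L2} \<and> monochromatic \<chi> (x ` {1..k}))" by (elim exE)
  show ?case
  proof (intro exI[of _ "max L1 L2"] allI impI)
    fix \<kappa> :: "(nat \<Rightarrow> nat) \<Rightarrow> 'c" assume \<kappa>: "\<forall>w. \<kappa> w \<in> K"
    have "\<forall>y. restrict (\<lambda>w. \<kappa> (w(n := y))) W \<in> W \<rightarrow>\<^sub>E K" using \<kappa> by auto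
    from spec[OF L2, of "\<lambda>y. restrict (\<lambda>w. \<kappa> (w(n := y))) W", THEN mp, OF this] obtain x where
      x: "linear_solution l k M x" "x ` {1..k} \<subseteq> {1..L2}" and
      "monochromatic (\<lambda>y. restrict (\<lambda>w. \<kappa> (w(n := y))) W) (x ` {1..k})" by (elim exE conjE)
    then have mono: "\<kappa> (w(n := y)) = \<kappa> (w(n := y'))"
      if "y \<in> x ` {1..k}" "y' \<in> x ` {1..k}" "w \<in> W" for y y' w
      using monochromaticD[OF _ that(1,2)] that(3) by (metis (no_types, lifting) restrict_apply')
    have "\<forall>w. \<kappa> (w(n := x 1)) \<in> K" using \<kappa> by blast
    from spec[OF L1, of "\<lambda>w. \<kappa> (w(n := x 1))", THEN mp, OF this] obtain \<beta> where
      \<beta>: "\<forall>i<n. linear_solution l k M (\<beta> i) \<and> \<beta> i ` {1..k} \<subseteq> {1..L1}" and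
      mono': "monochromatic (\<lambda>w. \<kappa> (w(n := x 1))) (words n (\<lambda>i. \<beta> i ` {1..k}))" by (elim exE conjE)
    obtain c where c: "\<And>w. w \<in> words n (\<lambda>i. \<beta> i ` {1..k}) \<Longrightarrow> \<kappa> (w(n := x 1)) = c"
      using mono' unfolding monochromatic_def by auto
    let ?\<beta> = "\<beta>(n := x)"
    have "\<kappa> w = c" if w: "w \<in> words (Suc n) (\<lambda>i. ?\<beta> i ` {1..k})" for w
    proof -
      have w': "w(n := 0) \<in> words n (\<lambda>i. \<beta> i ` {1..k})" and wn: "w n \<in> x ` {1..k}"
        using w unfolding words_def by (auto simp: less_Suc_eq split: if_splits)
      have "w(n := 0) \<in> W"
        using w' \<beta> unfolding W_def words_def by blast
      then have "\<kappa> ((w(n := 0))(n := w n)) = \<kappa> ((w(n := 0))(n := x 1))"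
        using k by (intro mono[OF wn]) auto
      then show ?thesis using c[OF w'] by simp
    qed
    moreover have "\<forall>i<Suc n. linear_solution l k M (?\<beta> i) \<and> ?\<beta> i ` {1..k} \<subseteq> {1..max L1 L2}"
      using \<beta> x by (fastforce simp: less_Suc_eq)
    ultimately show "\<exists>\<beta>. (\<forall>i<Suc n. linear_solution l k M (\<beta> i) \<and> \<beta> i ` {1..k} \<subseteq> {1..max L1 L2}) \<and>
        monochromatic \<kappa> (words (Suc n) (\<lambda>i. \<beta> i ` {1..k}))"
      unfolding monochromatic_def by (intro exI[of _ ?\<beta>]) blast
  qed
qed

section \<open>Monomials and the stagewise construction\<close>

definition monomial :: "(nat \<Rightarrow> zpoly) \<Rightarrow> (nat \<Rightarrow> nat) \<Rightarrow> nat \<Rightarrow> nat \<Rightarrow> zpoly" where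
  "monomial v w a b = (\<Prod>i=a..<b. v i ^ w i)"

lemma monomial_cong:
  "(\<And>i. a \<le> i \<Longrightarrow> i < b \<Longrightarrow> v i = v' i \<and> w i = w' i) \<Longrightarrow> monomial v w a b = monomial v' w' a b"
  unfolding monomial_def by (intro prod.cong) auto

lemma monomial_Suc: "a \<le> b \<Longrightarrow> monomial v w a (Suc b) = monomial v w a b * v b ^ w b"
  by (simp add: monomial_def)

lemma monomial_concat: "a \<le> b \<Longrightarrow> b \<le> c \<Longrightarrow> monomial v w a b * monomial v w b c = monomial v w a c"
  unfolding monomial_def by (rule prod.atLeastLessThan_concat)

lemma power_cone: "x \<in> cone \<Longrightarrow> x ^ n \<in> cone"
  by (induction n) (auto intro: cone.one cone.mult)

lemma monomial_cone: "(\<And>i. i < b \<Longrightarrow> v i \<in> cone) \<Longrightarrow> monomial v w a b \<in> cone"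
  unfolding monomial_def by (intro prod_cone power_cone) auto

text \<open>Raising all exponents to \<open>L\<close> gives one common multiple of all prefixes, the
  analogue of \<open>\<mu>\<close> in the focusing argument.\<close>

lemma monomial_dvd:
  assumes v: "\<And>i. i < n \<Longrightarrow> v i \<in> cone" and w: "\<And>i. i < n \<Longrightarrow> w i \<le> L" and j: "j \<le> n"
  obtains u where "u \<in> cone" "monomial v (\<lambda>_. L) 0 n = monomial v w 0 j * u"
proof
  show "monomial v (\<lambda>i. L - w i) 0 j * monomial v (\<lambda>_. L) j n \<in> cone"
    by (intro cone.mult monomial_cone) (use v j in auto)
  have "monomial v (\<lambda>_. L) 0 j = monomial v w 0 j * monomial v (\<lambda>i. L - w i) 0 j"
    unfolding monomial_def prod.distrib[symmetric] power_add[symmetric] using w j by (intro prod.cong) auto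
  then show "monomial v (\<lambda>_. L) 0 n = monomial v w 0 j * (monomial v (\<lambda>i. L - w i) 0 j * monomial v (\<lambda>_. L) j n)"
    using monomial_concat[of 0 j n v "\<lambda>_. L"] j by (simp add: mult.assoc)
qed

text \<open>State after \<open>n\<close> stages: on \<open>D\<close> the colours of all monomial multiples with exponents in
  \<open>{1..L}\<close> are constant, and adding \<open>q (z)\<close> to \<open>x v\<^sub>0\<^bsup>w 0\<^esup> \<cdots> v\<^sub>j\<^sub>-\<^sub>1\<^bsup>w (j-1)\<^esup>\<close>
  keeps its colour when \<open>N z\<close> is the complementary monomial in \<open>v\<^sub>j, \<dots>, v\<^sub>m\<^sub>-\<^sub>1\<close>.\<close>

definition geometric_state ::
  "(zpoly \<Rightarrow> nat) \<Rightarrow> zpoly \<Rightarrow> zpoly poly set \<Rightarrow> nat \<Rightarrow> nat \<Rightarrow> (nat \<Rightarrow> zpoly) \<Rightarrow> zpoly set \<Rightarrow> bool" where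
  "geometric_state \<chi> N Q L n v D \<longleftrightarrow> D \<subseteq> cone \<and> cone.large D \<and> (\<forall>i<n. v i \<in> cone) \<and>
     (\<forall>w. (\<forall>i<n. w i \<in> {1..L}) \<longrightarrow>
       (\<forall>m\<le>n. monochromatic (\<lambda>x. \<chi> (x * monomial v w 0 m)) D) \<and>
       (\<forall>m\<le>n. \<forall>j<m. \<exists>z\<in>cone. monomial v w j m = N * z \<and> (\<forall>q\<in>Q. \<forall>x\<in>D.
          x * monomial v w 0 j + poly q z \<in> cone \<and>
          \<chi> (x * monomial v w 0 j + poly q z) = \<chi> (x * monomial v w 0 j))))"

text \<open>The new factor is \<open>N * \<mu> * s\<close> with \<open>s\<close> from polynomial
  recurrence. As \<open>\<mu>\<close> is a multiple of every prefix monomial, \<open>q(z)\<close> is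
  that prefix times a polynomial in \<open>s\<close> without constant term. Adding it thus amounts
  to replacing \<open>x\<close> by another point of \<open>D\<close>, and the old state fixes the
  colour. A final shrinking fixes the colours of the new full monomials.\<close>

lemma geometric_state_Suc:
  assumes \<chi>: "\<forall>x\<in>cone. \<chi> x < r" and N: "N \<in> cone" and Q: "finite Q" "\<forall>q\<in>Q. coeff q 0 = 0"
    and state: "geometric_state \<chi> N Q L n v D"
  shows "\<exists>v' D'. geometric_state \<chi> N Q L (Suc n) v' D'"
proof -
  note mult = cone.mult
  have D: "D \<subseteq> cone" "cone.large D" and v: "\<And>i. i < n \<Longrightarrow> v i \<in> cone"
    using state unfolding geometric_state_def by auto
  have old_col: "monochromatic (\<lambda>x. \<chi> (x * monomial v w 0 m)) D"
    if "\<forall>i<n. w i \<in> {1..L}" "m \<le> n" for w m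
    using state that unfolding geometric_state_def by blast
  have old_shift: "\<exists>z\<in>cone. monomial v w j m = N * z \<and> (\<forall>q\<in>Q. \<forall>x\<in>D.
          x * monomial v w 0 j + poly q z \<in> cone \<and>
          \<chi> (x * monomial v w 0 j + poly q z) = \<chi> (x * monomial v w 0 j))"
    if "\<forall>i<n. w i \<in> {1..L}" "m \<le> n" "j < m" for w m j
    using state that unfolding geometric_state_def by blast
  define W where "W = {..<Suc n} \<rightarrow>\<^sub>E {1..L}"
  have W: "finite W" unfolding W_def by (intro finite_PiE) auto
  have WD: "w i \<in> {1..L}" if "w \<in> W" "i < Suc n" for w i
    using that PiE_mem[of w "{..<Suc n}" "\<lambda>_. {1..L}" i] unfolding W_def by simp
  define \<mu> where "\<mu> = monomial v (\<lambda>_. L) 0 n"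
  have \<mu>: "\<mu> \<in> cone" unfolding \<mu>_def by (rule monomial_cone) (rule v)
  \<comment> \<open>The monomial from position \<open>j\<close> on, divided by \<open>N\<close>: as
    \<open>w n \<ge> 1\<close>, one factor \<open>N * \<mu> * s\<close> is available from which
    \<open>N\<close> is split off.\<close>
  define z where "z w j s = monomial v w j n * \<mu> * s * (N * \<mu> * s) ^ (w n - 1)" for w j s
  have "\<exists>p. coeff p 0 = 0 \<and> (\<forall>s. poly q (z w j s) = monomial v w 0 j * poly p s)"
    if wjq: "w \<in> W" "j \<le> n" "q \<in> Q" for w j q
  proof -
    have le: "w i \<le> L" if "i < n" for i using WD[OF wjq(1), of i] that by simp
    obtain u where u: "u \<in> cone" "\<mu> = monomial v w 0 j * u"
      unfolding \<mu>_def by (rule monomial_dvd[OF v le wjq(2)])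
    obtain q' where q': "coeff q' 0 = 0" "\<And>s. monomial v w 0 j * poly q' s = poly q (monomial v w 0 j * s)"
      using dilated_poly[of q "monomial v w 0 j"] Q(2) wjq(3) by blast
    define p where "p = pcompose q' ([:0, monomial v w j n * u:] * [:0, N * \<mu>:] ^ (w n - 1))"
    have p: "poly p s = poly q' (monomial v w j n * u * s * (N * \<mu> * s) ^ (w n - 1))" for s
      by (simp add: p_def poly_pcompose ac_simps)
    have "z w j s = monomial v w 0 j * (monomial v w j n * u * s * (N * \<mu> * s) ^ (w n - 1))" for s
      unfolding z_def by (subst (1) u(2)) (simp add: ac_simps)
    then have "poly q (z w j s) = monomial v w 0 j * poly p s" for s
      unfolding p q'(2) by simp
    moreover have "coeff p 0 = 0" using p[of 0] q'(1) by (simp add: poly_0_coeff_0)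
    ultimately show ?thesis by blast
  qed
  then obtain p where p: "\<And>w j q. w \<in> W \<Longrightarrow> j \<le> n \<Longrightarrow> q \<in> Q \<Longrightarrow> coeff (p w j q) 0 = 0"
    "\<And>w j q s. w \<in> W \<Longrightarrow> j \<le> n \<Longrightarrow> q \<in> Q \<Longrightarrow> poly q (z w j s) = monomial v w 0 j * poly (p w j q) s"
    by metis
  define PP where "PP = (\<lambda>(w, j, q). p w j q) ` (W \<times> {..n} \<times> Q)"
  have PP: "finite PP" "\<forall>q\<in>PP. coeff q 0 = 0" using W Q(1) p(1) by (auto simp: PP_def)
  obtain s where s: "s \<in> cone" and ret: "cone.large {x\<in>D. \<forall>q\<in>PP. x + poly q s \<in> D}"
    using cone.polynomial_recurrence[OF PP D(2)] by blast
  define D1 where "D1 = {x\<in>D. \<forall>q\<in>PP. x + poly q s \<in> D}"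
  define v' where "v' = v(n := N * \<mu> * s)"
  have v'n: "v' n = N * \<mu> * s" by (simp add: v'_def)
  have v': "v' i \<in> cone" if "i < Suc n" for i
    using that v N \<mu> s by (auto simp: v'_def less_Suc_eq intro!: mult)
  have old: "monomial v' w a b = monomial v w a b" if "b \<le> n" for w a b
    by (rule monomial_cong) (use that in \<open>auto simp: v'_def\<close>)
  define f where "f x = restrict (\<lambda>w. \<chi> (x * monomial v' w 0 (Suc n))) W" for x
  have "f ` D1 \<subseteq> W \<rightarrow>\<^sub>E {..<r}"
  proof
    fix F assume "F \<in> f ` D1"
    then obtain x where x: "x \<in> D1" "F = f x" by blast
    have "x \<in> cone" using x(1) D(1) by (auto simp: D1_def)
    then have "\<chi> (x * monomial v' w 0 (Suc n)) < r" for w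
      by (intro bspec[OF \<chi>] mult monomial_cone v')
    then show "F \<in> W \<rightarrow>\<^sub>E {..<r}" by (auto simp: x(2) f_def)
  qed
  then have "finite (f ` D1)" by (rule finite_subset) (simp add: W finite_PiE)
  then obtain g where g: "cone.large {x\<in>D1. f x = g}"
    using cone.large_colour_class[OF ret[folded D1_def]] by blast
  define D2 where "D2 = {x\<in>D1. f x = g}"
  have D2D: "D2 \<subseteq> D" by (auto simp: D2_def D1_def)
  have shifted: "x + poly (p w j q) s \<in> D" if "x \<in> D2" "w \<in> W" "j \<le> n" "q \<in> Q" for x w j q
  proof -
    have "p w j q \<in> PP" unfolding PP_def using that by force
    then show ?thesis using that(1) by (simp add: D2_def D1_def)
  qed
  have "geometric_state \<chi> N Q L (Suc n) v' D2"
    unfolding geometric_state_def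
  proof (intro conjI allI impI)
    show "D2 \<subseteq> cone" using D2D D(1) by blast
    show "cone.large D2" using g by (simp add: D2_def)
    show "v' i \<in> cone" if "i < Suc n" for i by (rule v'[OF that])
  next
    fix w :: "nat \<Rightarrow> nat" and m
    assume w: "\<forall>i<Suc n. w i \<in> {1..L}" and m: "m \<le> Suc n"
    show "monochromatic (\<lambda>x. \<chi> (x * monomial v' w 0 m)) D2"
    proof (cases "m \<le> n")
      case True
      have "monochromatic (\<lambda>x. \<chi> (x * monomial v' w 0 m)) D"
        unfolding old[OF True] by (rule old_col) (use w True in auto)
      then show ?thesis by (rule monochromatic_subset) (rule D2D)
    next
      case False
      then have m: "m = Suc n" using m by simp
      define w' where "w' = restrict w {..<Suc n}"
      have w': "w' \<in> W" using w by (auto simp: w'_def W_def)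
      have eq: "monomial v' w 0 m = monomial v' w' 0 (Suc n)"
        unfolding m by (rule monomial_cong) (simp add: w'_def)
      have "\<chi> (x * monomial v' w' 0 (Suc n)) = g w'" if "x \<in> D2" for x
      proof -
        have "f x w' = \<chi> (x * monomial v' w' 0 (Suc n))" using w' by (simp add: f_def)
        moreover have "f x = g" using that by (simp add: D2_def)
        ultimately show ?thesis by simp
      qed
      then show ?thesis unfolding eq monochromatic_def by blast
    qed
  next
    fix w :: "nat \<Rightarrow> nat" and m j
    assume w: "\<forall>i<Suc n. w i \<in> {1..L}" and m: "m \<le> Suc n" and j: "j < m"
    show "\<exists>z\<in>cone. monomial v' w j m = N * z \<and> (\<forall>q\<in>Q. \<forall>x\<in>D2.
          x * monomial v' w 0 j + poly q z \<in> cone \<and>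
          \<chi> (x * monomial v' w 0 j + poly q z) = \<chi> (x * monomial v' w 0 j))"
    proof (cases "m \<le> n")
      case True
      have "j \<le> n" using j True by simp
      show ?thesis
        unfolding old[OF True] old[OF \<open>j \<le> n\<close>]
        using old_shift[of w m j] w True j D2D by (meson less_Suc_eq subsetD)
    next
      case False
      then have m: "m = Suc n" and jn: "j \<le> n" using m j by auto
      define w' where "w' = restrict w {..<Suc n}"
      have w': "w' \<in> W" using w by (auto simp: w'_def W_def)
      have w'n: "w' n = w n" by (simp add: w'_def)
      have eq: "monomial v' w a b = monomial v' w' a b" if "b \<le> Suc n" for a b
        by (rule monomial_cong) (use that in \<open>simp add: w'_def\<close>)
      have pos: "w' n = Suc (w' n - 1)" using WD[OF w', of n] by simp
      have "monomial v' w j m = monomial v w' j n * (N * \<mu> * s) ^ w' n"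
        unfolding m eq[OF order_refl] unfolding monomial_Suc[OF jn] v'n old[OF order_refl] by simp
      also have "\<dots> = N * z w' j s"
        unfolding z_def by (subst (1) pos) (simp add: ac_simps)
      finally have Nz: "monomial v' w j m = N * z w' j s" .
      have zc: "z w' j s \<in> cone"
        unfolding z_def by (intro mult power_cone monomial_cone v N \<mu> s)
      have m0: "monomial v' w 0 j = monomial v w' 0 j"
        using eq[of j 0] old[OF jn] jn by simp
      have m0c: "monomial v w' 0 j \<in> cone" by (rule monomial_cone) (use v jn in auto)
      have w'_le: "\<forall>i<n. w' i \<in> {1..L}" using WD[OF w'] by simp
      show ?thesis
      proof (intro bexI[of _ "z w' j s"] conjI ballI)
        show "monomial v' w j m = N * z w' j s" by (rule Nz)
        show "z w' j s \<in> cone" by (rule zc)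
        fix q x assume q: "q \<in> Q" and x: "x \<in> D2"
        have eq': "x * monomial v' w 0 j + poly q (z w' j s) = (x + poly (p w' j q) s) * monomial v w' 0 j"
          unfolding m0 p(2)[OF w' jn q] by (simp add: algebra_simps)
        have x': "x + poly (p w' j q) s \<in> D" by (rule shifted[OF x w' jn q])
        show "x * monomial v' w 0 j + poly q (z w' j s) \<in> cone"
          unfolding eq' by (rule mult[OF subsetD[OF D(1) x'] m0c])
        show "\<chi> (x * monomial v' w 0 j + poly q (z w' j s)) = \<chi> (x * monomial v' w 0 j)"
          unfolding eq' unfolding m0
          by (rule monochromaticD[OF old_col[OF w'_le jn] x' subsetD[OF D2D x]])
      qed
    qed
  qed
  then show ?thesis by blast
qed

lemma geometric_state_exists:
  assumes "\<forall>x\<in>cone. \<chi> x < r" "N \<in> cone" "finite Q" "\<forall>q\<in>Q. coeff q 0 = 0"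
  shows "\<exists>v D. geometric_state \<chi> N Q L n v D"
proof (induction n)
  case 0
  \<comment> \<open>Before the first stage the only monomial is 1, so a large colour class of the
    cone is enough.\<close>
  have "finite (\<chi> ` cone)" using assms(1) by (auto intro: finite_subset[of _ "{..<r}"])
  from cone.large_colour_class[OF cone.large_cone this] obtain c where
    c: "cone.large {x\<in>cone. \<chi> x = c}" by blast
  have "geometric_state \<chi> N Q L 0 (\<lambda>_. 1) {x\<in>cone. \<chi> x = c}"
    using c unfolding geometric_state_def by (auto simp: monomial_def monochromatic_def)
  then show ?case by blast
next
  case (Suc n)
  then show ?case using geometric_state_Suc[OF assms] by blast
qed

section \<open>Multiplicative solutions and the pigeonhole argument\<close>

lemma prod_powi:
  fixes f :: "'b \<Rightarrow> 'a::field"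
  shows "(\<Prod>i\<in>I. f i) powi n = (\<Prod>i\<in>I. f i powi n)"
  by (induction I rule: infinite_finite_induct) (simp_all add: power_int_mult_distrib)

lemma powi_sum:
  fixes a :: "'a::field"
  assumes "a \<noteq> 0" shows "a powi (\<Sum>i\<in>I. g i) = (\<Prod>i\<in>I. a powi g i)"
  by (induction I rule: infinite_finite_induct) (simp_all add: power_int_add assms)

text \<open>A linear solution in the exponents of one base solves the multiplicative system, and
  such solutions are closed under coordinatewise products.\<close>

lemma geometric_solutionI:
  fixes g :: "nat \<Rightarrow> nat"
  assumes sol: "\<And>i. i \<in> I \<Longrightarrow> linear_solution l k M (\<beta> i)" and g: "\<And>i. i \<in> I \<Longrightarrow> g i \<ge> 1"
  shows "(\<lambda>j. \<Prod>i\<in>I. g i ^ \<beta> i j) ` {1..k} \<in> geometric_solutions l k M"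
proof -
  have "(\<Prod>i\<in>I. g i ^ \<beta> i j) \<ge> 1" for j
    by (intro prod_ge_1) (use g in \<open>auto intro: one_le_power\<close>)
  moreover have "(\<Prod>j=1..k. (of_nat (\<Prod>i\<in>I. g i ^ \<beta> i j) :: rat) powi M e j) = 1" if "e \<in> {1..l}" for e
  proof -
    have "(\<Prod>j=1..k. (of_nat (\<Prod>i\<in>I. g i ^ \<beta> i j) :: rat) powi M e j) =
        (\<Prod>j=1..k. \<Prod>i\<in>I. of_nat (g i) powi (M e j * int (\<beta> i j)))"
      by (simp add: of_nat_prod prod_powi power_int_power mult.commute)
    also have "\<dots> = (\<Prod>i\<in>I. \<Prod>j=1..k. of_nat (g i) powi (M e j * int (\<beta> i j)))"
      by (rule prod.swap)
    also have "\<dots> = (\<Prod>i\<in>I. of_nat (g i) powi (\<Sum>j=1..k. M e j * int (\<beta> i j)))"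
      by (rule prod.cong[OF refl], subst powi_sum) (use g in fastforce)+
    also have "\<dots> = 1"
      by (rule prod.neutral) (use sol that in \<open>auto simp: linear_solution_def\<close>)
    finally show ?thesis .
  qed
  ultimately show ?thesis
    unfolding geometric_solutions_def
    by (intro CollectI exI[of _ "\<lambda>j. \<Prod>i\<in>I. g i ^ \<beta> i j"]) auto
qed

lemma val_monomial:
  assumes "\<And>i. i < b \<Longrightarrow> v i \<in> cone"
  shows "val \<rho> (monomial v w a b) = (\<Prod>i=a..<b. val \<rho> (v i) ^ w i)"
proof -
  have pow: "val \<rho> (x ^ n) = val \<rho> x ^ n" if "x \<in> cone" for x n
    by (induction n) (simp_all add: val_mult[OF that])
  have "val \<rho> (\<Prod>i\<in>I. v i ^ w i) = (\<Prod>i\<in>I. val \<rho> (v i) ^ w i)" if "finite I" "I \<subseteq> {..<b}" for I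
    using that
  proof (induction I rule: finite_induct)
    case (insert i I)
    then have "v i \<in> cone" using assms by simp
    then show ?case using insert by (simp add: val_mult[OF power_cone] pow)
  qed simp
  from this[of "{a..<b}"] show ?thesis by (simp add: monomial_def subset_eq)
qed

text \<open>The \<open>r + 1\<close> prefix lengths of a word get only \<open>r\<close> colours, so
  two lengths \<open>j < m\<close> agree. The prefix of length \<open>j\<close> gives
  \<open>a\<close>, and the segment from \<open>j\<close> to \<open>m\<close> gives
  \<open>N * z\<close>.\<close>

lemma geometric_rado_pattern_ramsey:
  assumes "geometric_rado_family \<B>" shows "pattern_ramsey \<B>"
  unfolding pattern_ramsey_def
proof (intro allI impI)
  obtain l k M where k: "k \<ge> 1" and \<B>: "\<B> = geometric_solutions l k M"
    and ramsey: "ramsey_family (linear_solutions l k M)"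
    using assms unfolding geometric_rado_family_def by blast
  fix r :: nat and \<chi> :: "zpoly \<Rightarrow> nat" and N :: zpoly and Q :: "zpoly poly set"
  assume \<chi>: "\<forall>x\<in>cone. \<chi> x < r" and N: "N \<in> cone" and Q: "finite Q" "\<forall>q\<in>Q. coeff q 0 = 0"
  define K where "K = {xs::nat list. set xs \<subseteq> {..<r} \<and> length xs = Suc r}"
  have "finite K" unfolding K_def by (rule finite_lists_length_eq) simp
  from ramsey_words[OF ramsey k this, of r] obtain L where L: "\<forall>\<kappa>. (\<forall>w. \<kappa> w \<in> K) \<longrightarrow>
    (\<exists>\<beta>. (\<forall>i<r. linear_solution l k M (\<beta> i) \<and> \<beta> i ` {1..k} \<subseteq> {1..L}) \<and>
      monochromatic \<kappa> (words r (\<lambda>i. \<beta> i ` {1..k})))" by (elim exE)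
  \<comment> \<open>The state treats all words with letters up to \<open>L\<close>, so the solutions
    \<open>\<beta>\<close> can be selected after it.\<close>
  obtain v D where state: "geometric_state \<chi> N Q L r v D"
    using geometric_state_exists[OF \<chi> N Q] by blast
  then have D: "D \<subseteq> cone" "cone.large D" and v: "\<And>i. i < r \<Longrightarrow> v i \<in> cone"
    unfolding geometric_state_def by auto
  obtain x0 where x0: "x0 \<in> D" using cone.large_nonempty[OF D(2)] by blast
  define col where "col w m = \<chi> (x0 * monomial v w 0 m)" for w m
  have col_less: "col w m < r" if "m \<le> r" for w m
    unfolding col_def
    by (intro bspec[OF \<chi>] cone.mult monomial_cone subsetD[OF D(1) x0] v) (use that in auto)
  \<comment> \<open>A word is coloured by the colours of all its prefixes, the empty one included,
    so that one choice of \<open>\<beta>\<close> serves all lengths.\<close>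
  define \<kappa> where "\<kappa> w = map (col w) [0..<Suc r]" for w
  have "\<forall>w. \<kappa> w \<in> K" using col_less by (auto simp: \<kappa>_def K_def)
  from spec[OF L, of \<kappa>, THEN mp, OF this] obtain \<beta> where
    \<beta>: "\<forall>i<r. linear_solution l k M (\<beta> i) \<and> \<beta> i ` {1..k} \<subseteq> {1..L}" and
    mono: "monochromatic \<kappa> (words r (\<lambda>i. \<beta> i ` {1..k}))" by (elim exE conjE)
  let ?W = "words r (\<lambda>i. \<beta> i ` {1..k})"
  define w1 where "w1 i = (if i < r then \<beta> i 1 else 0)" for i
  have w1: "w1 \<in> ?W" using k by (auto simp: words_def w1_def)
  have col_eq: "col w m = col w1 m" if "w \<in> ?W" "m \<le> r" for w m
  proof -
    have "\<kappa> w ! m = \<kappa> w1 ! m" using monochromaticD[OF mono that(1) w1] by simp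
    then show ?thesis using that(2) by (simp add: \<kappa>_def nth_append del: upt_Suc)
  qed
  have "\<not> inj_on (col w1) {..r}"
  proof
    assume inj: "inj_on (col w1) {..r}"
    have "col w1 ` {..r} \<subseteq> {..<r}" using col_less by auto
    from card_inj_on_le[OF inj this] show False by simp
  qed
  then obtain j m where jm: "j < m" "m \<le> r" "col w1 j = col w1 m"
    unfolding inj_on_def by (metis atMost_iff linorder_neqE_nat)
  have "j \<le> r" using jm by simp
  define w where "w e i = (if i < j then \<beta> i 1 else if i < r then \<beta> i e else 0)" for e i
  have wW: "w e \<in> ?W" if "e \<in> {1..k}" for e
    using that k \<open>j \<le> r\<close> by (auto simp: words_def w_def)
  have wL: "\<forall>i<r. w e i \<in> {1..L}" if "e \<in> {1..k}" for e
    using wW[OF that] \<beta> unfolding words_def by blast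
  have w0j: "monomial v (w e) 0 j = monomial v w1 0 j" for e
    by (rule monomial_cong) (use \<open>j \<le> r\<close> in \<open>auto simp: w_def w1_def\<close>)
  have same: "\<chi> (x * monomial v (w e) 0 i) = col w1 i" if "e \<in> {1..k}" "i \<le> r" "x \<in> D" for e i x
  proof -
    have "monochromatic (\<lambda>x. \<chi> (x * monomial v (w e) 0 i)) D"
      using state wL[OF that(1)] that(2) unfolding geometric_state_def by blast
    from monochromaticD[OF this that(3) x0] show ?thesis
      using col_eq[OF wW[OF that(1)] that(2)] by (simp add: col_def)
  qed
  have "\<forall>e\<in>{1..k}. \<exists>z\<in>cone. monomial v (w e) j m = N * z \<and> (\<forall>q\<in>Q. \<forall>x\<in>D.
          x * monomial v (w e) 0 j + poly q z \<in> cone \<and>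
          \<chi> (x * monomial v (w e) 0 j + poly q z) = \<chi> (x * monomial v (w e) 0 j))"
    using state wL jm(1,2) unfolding geometric_state_def by blast
  then obtain z where z: "\<And>e. e \<in> {1..k} \<Longrightarrow> z e \<in> cone"
    "\<And>e. e \<in> {1..k} \<Longrightarrow> monomial v (w e) j m = N * z e"
    "\<And>e q x. e \<in> {1..k} \<Longrightarrow> q \<in> Q \<Longrightarrow> x \<in> D \<Longrightarrow> x * monomial v (w e) 0 j + poly q (z e) \<in> cone \<and>
      \<chi> (x * monomial v (w e) 0 j + poly q (z e)) = \<chi> (x * monomial v (w e) 0 j)"
    by metis
  define \<mu> where "\<mu> = monomial v w1 0 j"
  have \<mu>: "\<mu> \<in> cone" unfolding \<mu>_def by (rule monomial_cone) (use v \<open>j \<le> r\<close> in auto)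
  have one_k: "1 \<in> {1..k}" using k by simp
  have "pattern_solution \<B> \<chi> N Q ((\<lambda>x. x * \<mu>) ` D) (z ` {1..k}) (col w1 j)"
    unfolding pattern_solution_def
  proof (intro conjI allI ballI)
    show "(\<lambda>x. x * \<mu>) ` D \<subseteq> cone" using D(1) by (auto intro: cone.mult[OF _ \<mu>])
    show "\<exists>a. cone.chain_in ((\<lambda>x. x * \<mu>) ` D) n a" for n
      using cone.large_chain[OF D(2)] cone.chain_in_mult[OF _ \<mu>] by blast
    show "z ` {1..k} \<subseteq> cone" using z(1) by blast
    show "finite (z ` {1..k})" "z ` {1..k} \<noteq> {}" using k by auto
    show "good \<B> ((*) N ` z ` {1..k})"
      unfolding good_def
    proof
      fix \<rho>
      have v_m: "v i \<in> cone" if "i < m" for i using that jm(2) v by simp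
      have "val \<rho> (N * z e) = (\<Prod>i=j..<m. val \<rho> (v i) ^ \<beta> i e)" if "e \<in> {1..k}" for e
      proof -
        have "val \<rho> (monomial v (w e) j m) = (\<Prod>i=j..<m. val \<rho> (v i) ^ w e i)"
          by (rule val_monomial) (rule v_m)
        also have "\<dots> = (\<Prod>i=j..<m. val \<rho> (v i) ^ \<beta> i e)"
          by (rule prod.cong) (use jm(2) in \<open>auto simp: w_def\<close>)
        finally show ?thesis unfolding z(2)[OF that] .
      qed
      then have "val \<rho> ` (*) N ` z ` {1..k} = (\<lambda>e. \<Prod>i=j..<m. val \<rho> (v i) ^ \<beta> i e) ` {1..k}"
        unfolding image_image by (intro image_cong) auto
      also have "\<dots> \<in> \<B>"
        unfolding \<B> by (rule geometric_solutionI) (use \<beta> jm(2) val_ge_1[OF v_m] in auto)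
      finally show "\<exists>B\<in>\<B>. B \<subseteq> val \<rho> ` (*) N ` z ` {1..k}" by blast
    qed
  next
    fix a assume "a \<in> (\<lambda>x. x * \<mu>) ` D"
    then obtain x where x: "x \<in> D" "a = x * monomial v (w e) 0 j" for e
      unfolding \<mu>_def w0j by blast
    show a: "\<chi> a = col w1 j" using same[OF one_k \<open>j \<le> r\<close> x(1)] x(2) by simp
    fix y assume "y \<in> z ` {1..k}"
    then obtain e where e: "e \<in> {1..k}" "y = z e" by blast
    have "a * N * y = x * (monomial v (w e) 0 j * monomial v (w e) j m)"
      unfolding z(2)[OF e(1)] e(2) x(2)[of e] by (simp add: ac_simps)
    also have "\<dots> = x * monomial v (w e) 0 m"
      by (subst monomial_concat) (use jm(1) in auto)
    finally show "\<chi> (a * N * y) = col w1 j" using same[OF e(1) jm(2) x(1)] jm(3) by simp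
    fix q assume "q \<in> Q"
    from z(3)[OF e(1) this x(1)] show "a + poly q y \<in> cone" "\<chi> (a + poly q y) = col w1 j"
      using a unfolding e(2) x(2)[of e, symmetric] by auto
  qed
  then show "\<exists>A Z c. pattern_solution \<B> \<chi> N Q A Z c" by (intro exI)
qed

lemma rado_tower_pattern_ramsey: "\<B> \<in> rado_tower \<Longrightarrow> pattern_ramsey \<B>"
proof (induction rule: rado_tower.induct)
  case (linear \<B>)
  then show ?case by (intro scalable_imp_pattern_ramsey linear_rado_scalable)
next
  case (geometric \<B>)
  then show ?case by (rule geometric_rado_pattern_ramsey)
next
  case (pattern \<B> P m)
  then show ?case by (metis scalable_imp_pattern_ramsey pattern_ramsey_imp_scalable)
qed

theorem theorem1p2:
  fixes \<B> :: "nat set set" and P :: "nat poly set"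
  assumes "\<B> \<in> rado_tower"
    and "finite P" and "\<forall>p\<in>P. integral_poly p"
  shows "ramsey_family (infinite_pattern_family P \<B>)"
  using pattern_ramsey_imp_infinite[OF rado_tower_pattern_ramsey rado_tower_pos] assms by blast

end
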